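(* Every $\Pi^1_1$-Kurtz random real is $\Sigma^1_1$-Kurtz random, and there is a $\Sigma^1_1$-Kurtz random real that is not $\Pi^1_1$-Kurtz random. Moreover, a real is $\Sigma^1_1$-Kurtz random if and only if it is $\Delta^1_1$-Kurtz random.
   Context: A real is an element of $2^\omega$ with the uniform (fair-coin) measure $\mu$. For a lightface pointclass $\Gamma$ (such as $\Delta^1_1$, $\Sigma^1_1$, $\Pi^1_1$) of subsets of $2^\omega$, a real $x$ is $\Gamma$-Kurtz random if $x\notin A$ for every closed set $A\subseteq 2^\omega$ with $\mu(A)=0$ that belongs to $\Gamma$. *)

theory Defs
  imports "HOL-Probability.Probability"
begin

text \<open>
  Cantor space is the type \<^typ>\<open>nat \<Rightarrow> bool\<close> with the library's product topology
  of the discrete topology on \<^typ>\<open>bool\<close>.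
\<close>

type_synonym cantor = "nat \<Rightarrow> bool"

definition fair_coin_measure :: "cantor measure" where
  "fair_coin_measure = (\<Pi>\<^sub>M i\<in>UNIV. measure_pmf (bernoulli_pmf (1/2)))"

text \<open>
  The lightface pointclasses are defined by definability over the standard model of second-order
  arithmetic, in the version whose second-order variables range over functions from the natural
  numbers to the natural numbers. Number and function variables are both named by natural numbers.
\<close>

datatype tm =
    NVar nat
  | Zero
  | Succ tm
  | Plus tm tm
  | Times tm tm
  | FApp nat tm

datatype fm =
    Equal tm tm
  | Less tm tm
  | Neg fm
  | And fm fm
  | ExN nat fm
  | ExF nat fm

primrec tm_val :: "(nat \<Rightarrow> nat) \<Rightarrow> (nat \<Rightarrow> nat \<Rightarrow> nat) \<Rightarrow> tm \<Rightarrow> nat" where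
  "tm_val e F (NVar i) = e i"
| "tm_val e F Zero = 0"
| "tm_val e F (Succ s) = Suc (tm_val e F s)"
| "tm_val e F (Plus s t) = tm_val e F s + tm_val e F t"
| "tm_val e F (Times s t) = tm_val e F s * tm_val e F t"
| "tm_val e F (FApp i t) = F i (tm_val e F t)"

primrec sat :: "(nat \<Rightarrow> nat) \<Rightarrow> (nat \<Rightarrow> nat \<Rightarrow> nat) \<Rightarrow> fm \<Rightarrow> bool" where
  "sat e F (Equal s t) \<longleftrightarrow> tm_val e F s = tm_val e F t"
| "sat e F (Less s t) \<longleftrightarrow> tm_val e F s < tm_val e F t"
| "sat e F (Neg p) \<longleftrightarrow> \<not> sat e F p"
| "sat e F (And p q) \<longleftrightarrow> sat e F p \<and> sat e F q"
| "sat e F (ExN i p) \<longleftrightarrow> (\<exists>n. sat (e(i := n)) F p)"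
| "sat e F (ExF i p) \<longleftrightarrow> (\<exists>f. sat e (F(i := f)) p)"

primrec arithmetical :: "fm \<Rightarrow> bool" where
  "arithmetical (Equal s t) \<longleftrightarrow> True"
| "arithmetical (Less s t) \<longleftrightarrow> True"
| "arithmetical (Neg p) \<longleftrightarrow> arithmetical p"
| "arithmetical (And p q) \<longleftrightarrow> arithmetical p \<and> arithmetical q"
| "arithmetical (ExN i p) \<longleftrightarrow> arithmetical p"
| "arithmetical (ExF i p) \<longleftrightarrow> False"

inductive sigma11_fm :: "fm \<Rightarrow> bool" where
  "arithmetical p \<Longrightarrow> sigma11_fm p"
| "sigma11_fm p \<Longrightarrow> sigma11_fm (ExF i p)"

text \<open>
  The real is passed, as its characteristic function, in function variable 0. The truth value must
  not depend on the values of any other variable; this is what excludes parameters and makes the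
  pointclasses lightface.
\<close>

definition defines_set :: "fm \<Rightarrow> cantor set \<Rightarrow> bool" where
  "defines_set p A \<longleftrightarrow> (\<forall>x e F. sat e (F(0 := (\<lambda>n. of_bool (x n)))) p \<longleftrightarrow> x \<in> A)"

definition Sigma11 :: "cantor set set" where
  "Sigma11 = {A. \<exists>p. sigma11_fm p \<and> defines_set p A}"

definition Pi11 :: "cantor set set" where
  "Pi11 = {A. - A \<in> Sigma11}"

definition Delta11 :: "cantor set set" where
  "Delta11 = Sigma11 \<inter> Pi11"

definition kurtz_random :: "cantor set set \<Rightarrow> cantor \<Rightarrow> bool" where
  "kurtz_random \<Gamma> x \<longleftrightarrow> (\<forall>A. closed A \<and> A \<in> null_sets fair_coin_measure \<and> A \<in> \<Gamma> \<longrightarrow> x \<notin> A)"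

end

theory Submission
  imports Defs
begin

text \<open>
  Ordinals are avoided: on the well-founded part of a relation, \<open>b\<close> has at least the rank of \<open>a\<close>
  iff some simulation relates \<open>a\<close> to \<open>b\<close>, which is a \<open>\<Sigma>\<^sup>1\<^sub>1\<close> condition. One arithmetically presented
  forest of partial Tarskian valuations has a universal \<open>\<Pi>\<^sup>1\<^sub>1\<close> well-founded part \<open>WF\<close>, so comparing
  ranks uniformizes \<open>\<Pi>\<^sup>1\<^sub>1\<close> relations on numbers.

  If a closed null set is \<open>\<Sigma>\<^sup>1\<^sub>1\<close>, then "the clopen set \<open>c\<close> has measure at most \<open>2\<^sup>-\<^sup>k\<close> and covers it"
  is \<open>\<Pi>\<^sup>1\<^sub>1\<close>. Uniformizing yields a total, hence \<open>\<Delta>\<^sup>1\<^sub>1\<close>, choice of covers, and their intersection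
  is a \<open>\<Delta>\<^sup>1\<^sub>1\<close> closed null superset.

  For the separation, a real is built by finite extensions. Stage \<open>p\<close> writes the bit \<open>p \<in> WF\<close>, then
  a bit telling whether the current string has an extension whose cylinder misses the \<open>p\<close>-th
  \<open>\<Sigma>\<^sup>1\<^sub>1\<close> set, and if so appends such an extension of least rank. Closed null sets are nowhere dense,
  so every \<open>\<Sigma>\<^sup>1\<^sub>1\<close> one is avoided. The real is a \<open>\<Pi>\<^sup>1\<^sub>1\<close> singleton: positive claims
  and least-rank extensions can be verified in a \<open>\<Pi>\<^sup>1\<^sub>1\<close> way, and the set of positive claims, being
  contained in \<open>WF\<close>, equals \<open>WF\<close> as soon as it is closed under the rule generating \<open>WF\<close>.
\<close>

section \<open>Definable predicates\<close>

type_synonym predicate = "(nat \<Rightarrow> nat) \<Rightarrow> (nat \<Rightarrow> nat \<Rightarrow> nat) \<Rightarrow> bool"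
type_synonym functional = "(nat \<Rightarrow> nat) \<Rightarrow> (nat \<Rightarrow> nat \<Rightarrow> nat) \<Rightarrow> nat"

section \<open>Renaming variables and de Bruijn style quantification\<close>

primrec ren_tm :: "(nat \<Rightarrow> nat) \<Rightarrow> (nat \<Rightarrow> nat) \<Rightarrow> tm \<Rightarrow> tm" where
  "ren_tm r q (NVar i) = NVar (r i)"
| "ren_tm r q Zero = Zero"
| "ren_tm r q (Succ s) = Succ (ren_tm r q s)"
| "ren_tm r q (Plus s t) = Plus (ren_tm r q s) (ren_tm r q t)"
| "ren_tm r q (Times s t) = Times (ren_tm r q s) (ren_tm r q t)"
| "ren_tm r q (FApp i t) = FApp (q i) (ren_tm r q t)"

primrec ren_fm :: "(nat \<Rightarrow> nat) \<Rightarrow> (nat \<Rightarrow> nat) \<Rightarrow> fm \<Rightarrow> fm" where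
  "ren_fm r q (Equal s t) = Equal (ren_tm r q s) (ren_tm r q t)"
| "ren_fm r q (Less s t) = Less (ren_tm r q s) (ren_tm r q t)"
| "ren_fm r q (Neg p) = Neg (ren_fm r q p)"
| "ren_fm r q (And p p') = And (ren_fm r q p) (ren_fm r q p')"
| "ren_fm r q (ExN i p) = ExN (r i) (ren_fm r q p)"
| "ren_fm r q (ExF i p) = ExF (q i) (ren_fm r q p)"

lemma tm_val_ren: "tm_val e F (ren_tm r q t) = tm_val (\<lambda>i. e (r i)) (\<lambda>i. F (q i)) t"
  by (induction t) auto

lemma fun_upd_ren: "inj r \<Longrightarrow> (\<lambda>j. if r j = r i then n else e (r j)) = (\<lambda>j. e (r j))(i := n)"
  by (auto simp: fun_eq_iff dest: injD)

text \<open>Injectivity prevents capture: updating a renamed bound variable changes no other renamed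
  variable.\<close>

lemma sat_ren:
  assumes "inj r" "inj q"
  shows "sat e F (ren_fm r q p) = sat (\<lambda>i. e (r i)) (\<lambda>i. F (q i)) p"
  using assms
  by (induction p arbitrary: e F) (simp_all add: tm_val_ren fun_upd_ren)

lemma arithmetical_ren [simp]: "arithmetical (ren_fm r q p) = arithmetical p"
  by (induction p) auto

lemma sigma11_fm_ren: "sigma11_fm p \<Longrightarrow> sigma11_fm (ren_fm r q p)"
  by (induction rule: sigma11_fm.induct) (auto intro: sigma11_fm.intros)

text \<open>A semantic stand-in for having finitely many free variables; the bound \<open>N\<close>
  supplies an index beyond all relevant ones, so no syntactic notion of freshness is
  developed.\<close>

definition finite_support :: "((nat \<Rightarrow> nat) \<Rightarrow> (nat \<Rightarrow> nat \<Rightarrow> nat) \<Rightarrow> 'a) \<Rightarrow> bool" where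
  "finite_support \<Phi> \<longleftrightarrow>
    (\<exists>N. \<forall>e e' F F'. (\<forall>i<N. e i = e' i \<and> F i = F' i) \<longrightarrow> \<Phi> e F = \<Phi> e' F')"

lemma finite_support_const: "finite_support (\<lambda>e F. c)"
  by (simp add: finite_support_def)

lemma finite_support_comp2:
  assumes "finite_support \<Phi>" "finite_support \<Psi>"
  shows "finite_support (\<lambda>e F. h (\<Phi> e F) (\<Psi> e F))"
proof -
  obtain N M where N: "\<And>e e' F F'. (\<forall>i<N. e i = e' i \<and> F i = F' i) \<Longrightarrow> \<Phi> e F = \<Phi> e' F'"
    and M: "\<And>e e' F F'. (\<forall>i<M. e i = e' i \<and> F i = F' i) \<Longrightarrow> \<Psi> e F = \<Psi> e' F'"
    using assms unfolding finite_support_def by metis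
  show ?thesis unfolding finite_support_def
  proof (intro exI[of _ "max N M"] allI impI)
    fix e e' :: "nat \<Rightarrow> nat" and F F' :: "nat \<Rightarrow> nat \<Rightarrow> nat"
    assume "\<forall>i<max N M. e i = e' i \<and> F i = F' i"
    then have "\<Phi> e F = \<Phi> e' F'" "\<Psi> e F = \<Psi> e' F'" using N M by simp_all
    then show "h (\<Phi> e F) (\<Psi> e F) = h (\<Phi> e' F') (\<Psi> e' F')" by simp
  qed
qed

lemmas finite_support_comp1 = finite_support_comp2[OF _ finite_support_const, where h = "\<lambda>x y. h x"] for h

lemma finite_support_var: "finite_support (\<lambda>e F. e i)" "finite_support (\<lambda>e F. F i)"
  unfolding finite_support_def by (rule exI[of _ "Suc i"], simp)+

lemma finite_support_upd:
  assumes "finite_support \<Phi>"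
  shows "finite_support (\<lambda>e F n. \<Phi> (e(i := n)) F)" "finite_support (\<lambda>e F f. \<Phi> e (F(i := f)))"
proof -
  obtain N where N: "\<And>e e' F F'. (\<forall>i<N. e i = e' i \<and> F i = F' i) \<Longrightarrow> \<Phi> e F = \<Phi> e' F'"
    using assms unfolding finite_support_def by metis
  show "finite_support (\<lambda>e F n. \<Phi> (e(i := n)) F)" "finite_support (\<lambda>e F f. \<Phi> e (F(i := f)))"
    unfolding finite_support_def by (intro exI[of _ N] allI impI ext N; simp)+
qed

lemma finite_support_tm_val: "finite_support (\<lambda>e F. tm_val e F t)"
proof (induction t)
  case (FApp i t)
  then show ?case
    using finite_support_comp2[OF finite_support_var(2)[of i], where h = "\<lambda>f n. f n"] by simp
qed (auto intro: finite_support_const finite_support_var finite_support_comp1[where h = Suc]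
    finite_support_comp2[where h = "(+)"] finite_support_comp2[where h = "(*)"])

lemma finite_support_sat: "finite_support (\<lambda>e F. sat e F p)"
proof (induction p)
  case (ExN i p)
  then show ?case
    using finite_support_comp1[OF finite_support_upd(1)[where i = i], where h = "\<lambda>f. \<exists>n. f n"] by simp
next
  case (ExF i p)
  then show ?case
    using finite_support_comp1[OF finite_support_upd(2)[where i = i], where h = "\<lambda>f. \<exists>n. f n"] by simp
qed (auto intro: finite_support_tm_val finite_support_comp1[where h = Not]
    finite_support_comp2[where h = "(=)"] finite_support_comp2[where h = "(<)"]
    finite_support_comp2[where h = "(\<and>)"])

text \<open>A cyclic permutation of 0..N. Variable 0 moves to \<open>N\<close>, where it can be
  quantified, and the others step down; the plain predecessor map is not injective, as
  \<open>sat_ren\<close> requires.\<close>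

definition rotate_vars :: "nat \<Rightarrow> nat \<Rightarrow> nat" where
  "rotate_vars N j = (if j = 0 then N else if j \<le> N then j - 1 else j)"

lemma inj_rotate_vars: "inj (rotate_vars N)"
  by (rule injI) (auto simp: rotate_vars_def split: if_splits)

lemma rotate_vars_upd: "j \<le> N \<Longrightarrow> (e(N := n)) (rotate_vars N j) = case_nat n e j"
  by (cases j) (auto simp: rotate_vars_def)

text \<open>Above \<open>N\<close> the rotated and the shifted assignment may differ, but the truth
  of \<open>p\<close> depends only on variables below \<open>N\<close>.\<close>

lemma ExN_de_Bruijn:
  obtains N where "\<And>e F. sat e F (ExN N (ren_fm (rotate_vars N) id p)) = (\<exists>n. sat (case_nat n e) F p)"
proof -
  obtain N where N: "\<And>e e' F F'. (\<forall>i<N. e i = e' i \<and> F i = F' i) \<Longrightarrow> sat e F p = sat e' F' p"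
    using finite_support_sat[of p] unfolding finite_support_def by metis
  have "sat (e(N := n)) F (ren_fm (rotate_vars N) id p) = sat (case_nat n e) F p" for e F n
    unfolding sat_ren[OF inj_rotate_vars inj_on_id]
    by (rule N) (simp add: rotate_vars_upd del: fun_upd_apply)
  then show ?thesis by (intro that[of N]) (simp del: fun_upd_apply)
qed

lemma ExF_de_Bruijn:
  obtains N where "\<And>e F. sat e F (ExF N (ren_fm id (rotate_vars N) p)) = (\<exists>f. sat e (case_nat f F) p)"
proof -
  obtain N where N: "\<And>e e' F F'. (\<forall>i<N. e i = e' i \<and> F i = F' i) \<Longrightarrow> sat e F p = sat e' F' p"
    using finite_support_sat[of p] unfolding finite_support_def by metis
  have "sat e (F(N := f)) (ren_fm id (rotate_vars N) p) = sat e (case_nat f F) p" for e F f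
    unfolding sat_ren[OF inj_on_id inj_rotate_vars]
    by (rule N) (simp add: rotate_vars_upd del: fun_upd_apply)
  then show ?thesis by (intro that[of N]) (simp del: fun_upd_apply)
qed

section \<open>Arithmetical, Sigma-1-1 and Delta-1-1 predicates\<close>

definition ar :: "predicate \<Rightarrow> bool" where
  "ar P \<longleftrightarrow> (\<exists>p. arithmetical p \<and> (\<forall>e F. sat e F p \<longleftrightarrow> P e F))"

definition s11 :: "predicate \<Rightarrow> bool" where
  "s11 P \<longleftrightarrow> (\<exists>p. sigma11_fm p \<and> (\<forall>e F. sat e F p \<longleftrightarrow> P e F))"

definition d11 :: "predicate \<Rightarrow> bool" where
  "d11 P \<longleftrightarrow> s11 P \<and> s11 (\<lambda>e F. \<not> P e F)"

lemma case_nat_shift: "case_nat (e 0) (\<lambda>i. e (Suc i)) = e"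
  by (auto simp: fun_eq_iff split: nat.splits)

lemma ar_neg: "ar P \<Longrightarrow> ar (\<lambda>e F. \<not> P e F)"
  unfolding ar_def by (metis sat.simps(3) arithmetical.simps(3))

lemma ar_conj: "ar P \<Longrightarrow> ar Q \<Longrightarrow> ar (\<lambda>e F. P e F \<and> Q e F)"
  unfolding ar_def by (metis sat.simps(4) arithmetical.simps(4))

text \<open>
  Quantifier rules are in de Bruijn style: the quantified variable becomes variable 0 and the
  others move up by one.
\<close>

lemma ar_ex:
  assumes "ar (\<lambda>e F. P (\<lambda>i. e (Suc i)) F (e 0))"
  shows "ar (\<lambda>e F. \<exists>n. P e F n)"
proof -
  obtain p where p: "arithmetical p" "\<And>e F. sat e F p \<longleftrightarrow> P (\<lambda>i. e (Suc i)) F (e 0)"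
    using assms unfolding ar_def by blast
  obtain N where "\<And>e F. sat e F (ExN N (ren_fm (rotate_vars N) id p)) = (\<exists>n. sat (case_nat n e) F p)"
    using ExN_de_Bruijn[of p] by blast
  with p show ?thesis unfolding ar_def
    by (intro exI[of _ "ExN N (ren_fm (rotate_vars N) id p)"]) simp
qed

lemma ar_ren: "ar P \<Longrightarrow> inj r \<Longrightarrow> inj q \<Longrightarrow> ar (\<lambda>e F. P (\<lambda>i. e (r i)) (\<lambda>i. F (q i)))"
  unfolding ar_def by (metis arithmetical_ren sat_ren)

lemma s11_ren: "s11 P \<Longrightarrow> inj r \<Longrightarrow> inj q \<Longrightarrow> s11 (\<lambda>e F. P (\<lambda>i. e (r i)) (\<lambda>i. F (q i)))"
  unfolding s11_def by (metis sigma11_fm_ren sat_ren)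

lemma s11_exf:
  assumes "s11 (\<lambda>e F. P e (\<lambda>i. F (Suc i)) (F 0))"
  shows "s11 (\<lambda>e F. \<exists>f. P e F f)"
proof -
  obtain p where p: "sigma11_fm p" "\<And>e F. sat e F p \<longleftrightarrow> P e (\<lambda>i. F (Suc i)) (F 0)"
    using assms unfolding s11_def by blast
  obtain N where "\<And>e F. sat e F (ExF N (ren_fm id (rotate_vars N) p)) = (\<exists>f. sat e (case_nat f F) p)"
    using ExF_de_Bruijn[of p] by blast
  with p show ?thesis unfolding s11_def
    by (intro exI[of _ "ExF N (ren_fm id (rotate_vars N) p)"])
      (auto intro: sigma11_fm.intros sigma11_fm_ren)
qed

lemma s11_ar: "ar P \<Longrightarrow> s11 P"
  unfolding ar_def s11_def by (meson sigma11_fm.intros)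

text \<open>Arithmetical and Delta-1-1 predicates both obey these rules, so definable functionals
  and substitution are developed once for the two classes.\<close>

locale arith_closed =
  fixes K :: "predicate \<Rightarrow> bool"
  assumes K_ar: "ar P \<Longrightarrow> K P"
    and K_neg: "K P \<Longrightarrow> K (\<lambda>e F. \<not> P e F)"
    and K_conj: "K P \<Longrightarrow> K Q \<Longrightarrow> K (\<lambda>e F. P e F \<and> Q e F)"
    and K_ex: "K (\<lambda>e F. R (\<lambda>i. e (Suc i)) F (e 0)) \<Longrightarrow> K (\<lambda>e F. \<exists>n. R e F n)"
    and K_ren: "K P \<Longrightarrow> inj r \<Longrightarrow> inj q \<Longrightarrow> K (\<lambda>e F. P (\<lambda>i. e (r i)) (\<lambda>i. F (q i)))"
begin

definition fn :: "functional \<Rightarrow> bool" where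
  "fn t \<longleftrightarrow> K (\<lambda>e F. t (\<lambda>i. e (Suc i)) F = e 0)"

lemma fn_ar_graph: "ar (\<lambda>e F. t (\<lambda>i. e (Suc i)) F = e 0) \<Longrightarrow> fn t"
  unfolding fn_def by (rule K_ar)

lemma fn_atom: "fn (\<lambda>e F. tm_val e F t)"
proof (rule fn_ar_graph)
  have "sat e F (Equal (ren_tm Suc id t) (NVar 0)) \<longleftrightarrow> tm_val (\<lambda>i. e (Suc i)) F t = e 0" for e F
    by (simp add: tm_val_ren)
  then show "ar (\<lambda>e F. tm_val (\<lambda>i. e (Suc i)) F t = e 0)"
    unfolding ar_def by (metis arithmetical.simps(1))
qed

lemma fn_ren:
  assumes "fn t" "inj r" "inj q"
  shows "fn (\<lambda>e F. t (\<lambda>i. e (r i)) (\<lambda>i. F (q i)))"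
proof -
  define r' where "r' = case_nat 0 (\<lambda>i. Suc (r i))"
  have "inj r'" using inj_eq[OF assms(2)] by (intro injI) (simp add: r'_def split: nat.splits)
  from K_ren[OF assms(1)[unfolded fn_def] this assms(3)] show ?thesis
    unfolding fn_def r'_def by (simp only: nat.case)
qed

text \<open>Substituting a functional costs one number quantifier over its value, which replaces
  syntactic substitution.\<close>

lemma K_cases:
  assumes "K (\<lambda>e F. R (\<lambda>i. e (Suc i)) F (e 0))" "fn t"
  shows "K (\<lambda>e F. R e F (t e F))"
proof -
  have "K (\<lambda>e F. \<exists>n. t e F = n \<and> R e F n)"
    using assms by (intro K_ex K_conj) (simp_all add: fn_def)
  then show ?thesis by simp
qed

lemma fn_app:
  assumes G: "fn (\<lambda>e F. G (\<lambda>i. e (Suc i)) F (e 0))" and t: "fn t"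
  shows "fn (\<lambda>e F. G e F (t e F))"
proof -
  define sw where "sw i = (if i = 0 then 1 else if i = 1 then 0 else i)" for i :: nat
  have "inj sw" by (auto simp: sw_def inj_def split: if_splits)
  from K_ren[OF G[unfolded fn_def] this inj_on_id]
  have "K (\<lambda>e F. G (\<lambda>i. e (Suc (Suc i))) F (e 0) = e (Suc 0))" by (simp add: sw_def)
  then show ?thesis unfolding fn_def
    by (rule K_cases) (use fn_ren[OF t inj_Suc inj_on_id] in simp)
qed

lemma fn_sub2:
  assumes "fn (\<lambda>e F. g (e 0) (e (Suc 0)))" "fn t" "fn u"
  shows "fn (\<lambda>e F. g (t e F) (u e F))"
proof -
  have "fn (\<lambda>e F. g (e 0) (u (\<lambda>i. e (Suc i)) F))"
  proof (rule fn_app[where G = "\<lambda>e F n. g (e 0) n"])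
    have *: "inj (\<lambda>i. if i = 0 then 1 else if i = 1 then 0 else i :: nat)" (is "inj ?sw")
      by (auto simp: inj_def split: if_splits)
    show "fn (\<lambda>e F. g (e (Suc 0)) (e 0))"
      using fn_ren[OF assms(1) * inj_on_id] by simp
  qed (use fn_ren[OF assms(3) inj_Suc inj_on_id] in simp)
  then show ?thesis
    by (rule fn_app[where G = "\<lambda>e F n. g n (u e F)", OF _ assms(2)])
qed

lemma fn_Suc: "fn t \<Longrightarrow> fn (\<lambda>e F. Suc (t e F))"
  using fn_app[where G = "\<lambda>e F n. Suc n"] fn_atom[of "Succ (NVar 0)"] by simp

lemma fn_zero: "fn (\<lambda>e F. 0)"
  using fn_atom[of Zero] by simp

lemma fn_plus: "fn t \<Longrightarrow> fn u \<Longrightarrow> fn (\<lambda>e F. t e F + u e F)"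
  using fn_sub2[where g = "(+)"] fn_atom[of "Plus (NVar 0) (NVar (Suc 0))"] by simp

lemma fn_times: "fn t \<Longrightarrow> fn u \<Longrightarrow> fn (\<lambda>e F. t e F * u e F)"
  using fn_sub2[where g = "(*)"] fn_atom[of "Times (NVar 0) (NVar (Suc 0))"] by simp

lemma K_sub2:
  assumes "ar (\<lambda>e F. Q (e 0) (e (Suc 0)))" "fn t" "fn u"
  shows "K (\<lambda>e F. Q (t e F) (u e F))"
proof -
  have "inj (\<lambda>i. if i = 0 then 1 else if i = 1 then 0 else i :: nat)" (is "inj ?sw")
    by (auto simp: inj_def split: if_splits)
  from K_ren[OF K_ar[OF assms(1)] this inj_on_id] have "K (\<lambda>e F. Q (e (Suc 0)) (e 0))" by simp
  then have "K (\<lambda>e F. Q (e 0) (u (\<lambda>i. e (Suc i)) F))"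
    by (rule K_cases) (use fn_ren[OF assms(3) inj_Suc inj_on_id] in simp)
  then show ?thesis by (rule K_cases) (fact assms(2))
qed

lemma K_eq: "fn t \<Longrightarrow> fn u \<Longrightarrow> K (\<lambda>e F. t e F = u e F)"
  by (rule K_sub2[where Q = "(=)"]) (auto simp: ar_def intro!: exI[of _ "Equal (NVar 0) (NVar (Suc 0))"])

lemma K_less: "fn t \<Longrightarrow> fn u \<Longrightarrow> K (\<lambda>e F. t e F < u e F)"
  by (rule K_sub2[where Q = "(<)"]) (auto simp: ar_def intro!: exI[of _ "Less (NVar 0) (NVar (Suc 0))"])

lemma fn_tm_val:
  assumes "\<And>i. fn (t i)" "\<And>i. fn (\<lambda>e F. G i (\<lambda>j. e (Suc j)) F (e 0))"
  shows "fn (\<lambda>e F. tm_val (\<lambda>i. t i e F) (\<lambda>i. G i e F) s)"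
proof (induction s)
  case (FApp i s)
  show ?case using fn_app[OF assms(2)[of i] FApp] by simp
qed (simp_all add: assms fn_zero fn_Suc fn_plus fn_times)

text \<open>Function arguments cannot be substituted by quantifying over their value, since that
  would take a function quantifier; hence the induction on the formula.\<close>

lemma K_sat:
  assumes "arithmetical p" "\<And>i. fn (t i)" "\<And>i. fn (\<lambda>e F. G i (\<lambda>j. e (Suc j)) F (e 0))"
  shows "K (\<lambda>e F. sat (\<lambda>i. t i e F) (\<lambda>i. G i e F) p)"
  using assms
proof (induction p arbitrary: t G)
  case (Equal s u)
  then show ?case by (simp add: K_eq fn_tm_val)
next
  case (Less s u)
  then show ?case by (simp add: K_less fn_tm_val)
next
  case (Neg p)
  then show ?case by (simp add: K_neg)
next
  case (And p q)
  then show ?case by (simp add: K_conj)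
next
  case (ExN k p)
  \<comment> \<open>The bound number is variable 0 of the enlarged assignment: it replaces the term
    at \<open>k\<close>, and all other arguments are shifted.\<close>
  have "K (\<lambda>e F. sat (\<lambda>i. (if i = k then (\<lambda>e F. e 0) else (\<lambda>e F. t i (\<lambda>i. e (Suc i)) F)) e F)
    (\<lambda>i. G i (\<lambda>i. e (Suc i)) F) p)"
  proof (rule ExN.IH)
    show "arithmetical p" using ExN.prems by simp
    fix i
    show "fn (if i = k then (\<lambda>e F. e 0) else (\<lambda>e F. t i (\<lambda>i. e (Suc i)) F))"
      using fn_ren[OF ExN.prems(2)[of i] inj_Suc inj_on_id] fn_atom[of "NVar 0"] by simp
    have "inj (case_nat 0 (\<lambda>i. Suc (Suc i)))" by (auto simp: inj_def split: nat.splits)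
    from fn_ren[OF ExN.prems(3)[of i] this inj_on_id]
    show "fn (\<lambda>e F. G i (\<lambda>j. e (Suc (Suc j))) F (e 0))" by simp
  qed
  moreover have "(\<lambda>i. (if i = k then (\<lambda>e F. e 0) else (\<lambda>e F. t i (\<lambda>i. e (Suc i)) F)) e F)
      = (\<lambda>i. t i (\<lambda>i. e (Suc i)) F)(k := e 0)" for e F
    by auto
  ultimately have "K (\<lambda>e F. sat ((\<lambda>i. t i (\<lambda>i. e (Suc i)) F)(k := e 0)) (\<lambda>i. G i (\<lambda>i. e (Suc i)) F) p)"
    by simp
  from K_ex[where R = "\<lambda>e F n. sat ((\<lambda>i. t i e F)(k := n)) (\<lambda>i. G i e F) p", OF this]
  show ?case by simp
qed simp

lemma K_sub:
  assumes "ar P" "\<And>i. fn (t i)" "\<And>i. fn (\<lambda>e F. G i (\<lambda>j. e (Suc j)) F (e 0))"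
  shows "K (\<lambda>e F. P (\<lambda>i. t i e F) (\<lambda>i. G i e F))"
  using assms K_sat unfolding ar_def by force

end

interpretation ar: arith_closed ar
  by unfold_locales (auto intro: ar_neg ar_conj ar_ex ar_ren)

text \<open>Doubling removes the division in the triangular number and leaves a polynomial equation,
  which is atomic.\<close>

lemma prod_encode_graph: "prod_encode (a, b) = z \<longleftrightarrow> z + z = (a + b) * Suc (a + b) + (a + a)"
proof -
  have "2 * triangle n = n * Suc n" for n
    by (simp add: triangle_def)
  then have "2 * prod_encode (a, b) = (a + b) * Suc (a + b) + 2 * a"
    unfolding prod_encode_def by (simp only: prod.case distrib_left)
  then show ?thesis by (auto simp: mult_2)
qed

context arith_closed
begin

lemma fn_var: "fn (\<lambda>e F. e i)"
  using fn_atom[of "NVar i"] by simp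

lemma fn_prod_encode:
  assumes "fn t" "fn u" shows "fn (\<lambda>e F. prod_encode (t e F, u e F))"
proof (rule fn_sub2[where g = "\<lambda>a b. prod_encode (a, b)", OF _ assms])
  show "fn (\<lambda>e F. prod_encode (e 0, e (Suc 0)))"
    unfolding fn_def prod_encode_graph
    by (intro K_eq fn_plus fn_times fn_Suc fn_var)
qed

lemma fn_fapp: "fn t \<Longrightarrow> fn (\<lambda>e F. F i (t e F))"
  using fn_app[where G = "\<lambda>e F. F i"] fn_atom[of "FApp i (NVar 0)"] by simp

end

text \<open>Adjacent function quantifiers contract, because one function carries two on its even and
  its odd arguments.\<close>

lemma s11_iff: "s11 P \<longleftrightarrow> (\<exists>Q. ar Q \<and> P = (\<lambda>e F. \<exists>f. Q e (case_nat f F)))"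
proof
  assume "\<exists>Q. ar Q \<and> P = (\<lambda>e F. \<exists>f. Q e (case_nat f F))"
  then obtain Q where "ar Q" and P: "P = (\<lambda>e F. \<exists>f. Q e (case_nat f F))" by blast
  then have "s11 (\<lambda>e F. Q e (case_nat (F 0) (\<lambda>i. F (Suc i))))"
    by (simp add: case_nat_shift s11_ar)
  then show "s11 P" unfolding P
    by (rule s11_exf[where P = "\<lambda>e F f. Q e (case_nat f F)"])
next
  assume "s11 P"
  then obtain p where p: "sigma11_fm p" and P: "P = (\<lambda>e F. sat e F p)"
    unfolding s11_def by (auto simp: fun_eq_iff)
  show "\<exists>Q. ar Q \<and> P = (\<lambda>e F. \<exists>f. Q e (case_nat f F))"
    using p unfolding P
  proof (induction rule: sigma11_fm.induct)
    case (1 p)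
    then have "ar (\<lambda>e F. sat e F p)" unfolding ar_def by blast
    from ar_ren[OF this inj_on_id inj_Suc] show ?case
      by (intro exI[of _ "\<lambda>e F. sat e (\<lambda>i. F (Suc i)) p"]) simp
  next
    case (2 p k)
    then obtain Q where Q: "ar Q" "\<And>e F. sat e F p = (\<exists>f. Q e (case_nat f F))"
      by (auto simp: fun_eq_iff)
    \<comment> \<open>Slot 0 is the witness for the matrix and slot \<open>Suc k\<close> the
      quantified variable; both are read off the single function \<open>F 0\<close>.\<close>
    define G where "G i F = (case i of 0 \<Rightarrow> (\<lambda>m. F 0 (m + m)) |
      Suc j \<Rightarrow> if j = k then (\<lambda>m. F 0 (Suc (m + m))) else F (Suc j))"
      for i and F :: "nat \<Rightarrow> nat \<Rightarrow> nat"
    have "ar (\<lambda>e F. Q (\<lambda>i. e i) (\<lambda>i. G i F))"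
    proof (rule ar.K_sub[OF Q(1)])
      fix i
      show "ar.fn (\<lambda>e F. G i F (e 0))"
        by (cases i; cases "i = Suc k") (auto simp: G_def intro!: ar.fn_fapp ar.fn_plus ar.fn_Suc ar.fn_var)
    qed (rule ar.fn_var)
    moreover have "sat e F (ExF k p) = (\<exists>h. Q e (\<lambda>i. G i (case_nat h F)))" for e F
    proof
      assume "sat e F (ExF k p)"
      then obtain g f where gf: "Q e (case_nat f (F(k := g)))" by (auto simp: Q(2))
      define h where "h m = (if even m then f (m div 2) else g (m div 2))" for m
      have "h (m + m) = f m" "h (Suc (m + m)) = g m" for m
        by (auto simp: h_def mult_2[symmetric])
      then have "(\<lambda>i. G i (case_nat h F)) = case_nat f (F(k := g))"
        by (auto simp: G_def fun_eq_iff split: nat.splits)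
      with gf show "\<exists>h. Q e (\<lambda>i. G i (case_nat h F))" by metis
    next
      assume "\<exists>h. Q e (\<lambda>i. G i (case_nat h F))"
      then obtain h where h: "Q e (\<lambda>i. G i (case_nat h F))" by blast
      have "(\<lambda>i. G i (case_nat h F)) = case_nat (\<lambda>m. h (m + m)) (F(k := \<lambda>m. h (Suc (m + m))))"
        by (auto simp: G_def fun_eq_iff split: nat.splits)
      with h show "sat e F (ExF k p)" by (auto simp: Q(2) intro!: exI)
    qed
    ultimately show ?case by (intro exI[of _ "\<lambda>e F. Q e (\<lambda>i. G i F)"]) auto
  qed
qed

lemma s11_normal:
  assumes "s11 P"
  obtains Q where "ar Q" "\<And>e F. P e F \<longleftrightarrow> (\<exists>f. Q e (case_nat f F))"
  using assms unfolding s11_iff by blast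

lemma s11_exf_ar:
  assumes "ar (\<lambda>e F. P e (\<lambda>i. F (Suc i)) (F 0))"
  shows "s11 (\<lambda>e F. \<exists>f. P e F f)"
  using assms by (intro s11_exf s11_ar)

lemma s11_conj:
  assumes "s11 P" "s11 Q" shows "s11 (\<lambda>e F. P e F \<and> Q e F)"
proof -
  obtain P' where P': "ar P'" "\<And>e F. P e F \<longleftrightarrow> (\<exists>f. P' e (case_nat f F))"
    using s11_normal[OF assms(1)] by blast
  obtain Q' where Q': "ar Q'" "\<And>e F. Q e F \<longleftrightarrow> (\<exists>f. Q' e (case_nat f F))"
    using s11_normal[OF assms(2)] by blast
  have *: "inj (case_nat 0 (\<lambda>i. Suc (Suc i)))" "inj Suc"
    by (auto simp: inj_def split: nat.splits)
  have 1: "ar (\<lambda>e F. P' e (\<lambda>i. F (case_nat 0 (\<lambda>i. Suc (Suc i)) i)))"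
    using ar_ren[OF P'(1) inj_on_id *(1)] by simp
  have 2: "ar (\<lambda>e F. Q' e (\<lambda>i. F (Suc i)))"
    using ar_ren[OF Q'(1) inj_on_id *(2)] by simp
  have eq: "(\<lambda>i. F (case_nat 0 (\<lambda>i. Suc (Suc i)) i)) = case_nat (F 0) (\<lambda>i. F (Suc (Suc i)))"
    "(\<lambda>i. F (Suc i)) = case_nat (F (Suc 0)) (\<lambda>i. F (Suc (Suc i)))"
    for F :: "nat \<Rightarrow> nat \<Rightarrow> nat"
    by (auto simp: fun_eq_iff split: nat.splits)
  have "s11 (\<lambda>e F. \<exists>g f. P' e (case_nat f F) \<and> Q' e (case_nat g F))"
    using ar_conj[OF 1 2] unfolding eq by (intro s11_exf s11_ar)
  moreover have "(\<exists>g f. P' e (case_nat f F) \<and> Q' e (case_nat g F)) \<longleftrightarrow> P e F \<and> Q e F" for e F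
    unfolding P' Q' by blast
  ultimately show ?thesis by simp
qed

lemma ar_disj: "ar P \<Longrightarrow> ar Q \<Longrightarrow> ar (\<lambda>e F. P e F \<or> Q e F)"
  using ar_neg[OF ar_conj[OF ar_neg ar_neg]] by simp

lemma s11_disj:
  assumes "s11 P" "s11 Q" shows "s11 (\<lambda>e F. P e F \<or> Q e F)"
proof -
  obtain P' where P': "ar P'" "\<And>e F. P e F \<longleftrightarrow> (\<exists>f. P' e (case_nat f F))"
    using s11_normal[OF assms(1)] by blast
  obtain Q' where Q': "ar Q'" "\<And>e F. Q e F \<longleftrightarrow> (\<exists>f. Q' e (case_nat f F))"
    using s11_normal[OF assms(2)] by blast
  have "s11 (\<lambda>e F. \<exists>f. P' e (case_nat f F) \<or> Q' e (case_nat f F))"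
    using ar_disj[OF P'(1) Q'(1)] by (intro s11_exf_ar) (simp add: case_nat_shift)
  moreover have "(\<exists>f. P' e (case_nat f F) \<or> Q' e (case_nat f F)) \<longleftrightarrow> P e F \<or> Q e F" for e F
    unfolding P' Q' by blast
  ultimately show ?thesis by simp
qed

lemma s11_ex:
  assumes "s11 (\<lambda>e F. P (\<lambda>i. e (Suc i)) F (e 0))"
  shows "s11 (\<lambda>e F. \<exists>n. P e F n)"
proof -
  obtain Q where Q: "ar Q" "\<And>e F. P (\<lambda>i. e (Suc i)) F (e 0) \<longleftrightarrow> (\<exists>f. Q e (case_nat f F))"
    using s11_normal[OF assms] by blast
  have "ar (\<lambda>e F. \<exists>n. Q (case_nat n e) F)"
    using Q(1) by (intro ar_ex) (simp add: case_nat_shift)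
  then have "s11 (\<lambda>e F. \<exists>f n. Q (case_nat n e) (case_nat f F))"
    by (intro s11_exf_ar) (simp add: case_nat_shift)
  moreover have "(\<exists>f n. Q (case_nat n e) (case_nat f F)) \<longleftrightarrow> (\<exists>n. P e F n)" for e F
    using Q(2)[of "case_nat _ e" F] by auto
  ultimately show ?thesis by simp
qed

lemma ar_all:
  assumes "ar (\<lambda>e F. P (\<lambda>i. e (Suc i)) F (e 0))"
  shows "ar (\<lambda>e F. \<forall>n. P e F n)"
  using ar_neg[OF ar_ex[where P = "\<lambda>e F n. \<not> P e F n", OF ar_neg[OF assms]]] by simp

text \<open>Countable choice collects one witness per number into a single function, whose row
  \<open>n\<close> is read through pairing.\<close>

lemma s11_all:
  assumes "s11 (\<lambda>e F. P (\<lambda>i. e (Suc i)) F (e 0))"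
  shows "s11 (\<lambda>e F. \<forall>n. P e F n)"
proof -
  obtain Q where Q: "ar Q" "\<And>e F. P (\<lambda>i. e (Suc i)) F (e 0) \<longleftrightarrow> (\<exists>f. Q e (case_nat f F))"
    using s11_normal[OF assms] by blast
  define G where "G i e F = (case i of 0 \<Rightarrow> (\<lambda>m. F 0 (prod_encode (e 0, m))) | Suc j \<Rightarrow> F (Suc j))"
    for i and e :: "nat \<Rightarrow> nat" and F :: "nat \<Rightarrow> nat \<Rightarrow> nat"
  have "ar (\<lambda>e F. Q (\<lambda>i. e i) (\<lambda>i. G i e F))"
  proof (rule ar.K_sub[OF Q(1)])
    fix i
    show "ar.fn (\<lambda>e F. G i (\<lambda>j. e (Suc j)) F (e 0))"
      by (cases i) (auto simp: G_def intro!: ar.fn_fapp ar.fn_prod_encode ar.fn_var)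
  qed (rule ar.fn_var)
  moreover have "(\<lambda>i. G i e F) = case_nat (\<lambda>m. F 0 (prod_encode (e 0, m))) (\<lambda>i. F (Suc i))" for e F
    by (auto simp: G_def fun_eq_iff split: nat.splits)
  ultimately have "ar (\<lambda>e F. Q (case_nat (e 0) (\<lambda>i. e (Suc i)))
      (case_nat (\<lambda>m. F 0 (prod_encode (e 0, m))) (\<lambda>i. F (Suc i))))"
    by (simp add: case_nat_shift)
  from ar_all[where P = "\<lambda>e F n. Q (case_nat n e) (case_nat (\<lambda>m. F 0 (prod_encode (n, m))) (\<lambda>i. F (Suc i)))", OF this]
  have "s11 (\<lambda>e F. \<exists>f. \<forall>n. Q (case_nat n e) (case_nat (\<lambda>m. f (prod_encode (n, m))) F))"
    by (intro s11_exf_ar)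
  moreover have "(\<exists>f. \<forall>n. Q (case_nat n e) (case_nat (\<lambda>m. f (prod_encode (n, m))) F)) \<longleftrightarrow> (\<forall>n. P e F n)" for e F
  proof
    assume "\<exists>f. \<forall>n. Q (case_nat n e) (case_nat (\<lambda>m. f (prod_encode (n, m))) F)"
    then show "\<forall>n. P e F n" using Q(2)[of "case_nat _ e" F] by auto
  next
    assume "\<forall>n. P e F n"
    then have "\<forall>n. \<exists>f. Q (case_nat n e) (case_nat f F)"
      using Q(2)[of "case_nat _ e" F] by auto
    then obtain g where "\<forall>n. Q (case_nat n e) (case_nat (g n) F)" by metis
    then show "\<exists>f. \<forall>n. Q (case_nat n e) (case_nat (\<lambda>m. f (prod_encode (n, m))) F)"
      by (intro exI[of _ "\<lambda>k. case prod_decode k of (n, m) \<Rightarrow> g n m"]) simp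
  qed
  ultimately show ?thesis by simp
qed

section \<open>Delta-1-1 predicates and functionals\<close>

lemma d11_neg: "d11 P \<Longrightarrow> d11 (\<lambda>e F. \<not> P e F)"
  by (simp add: d11_def)

lemma d11_conj: "d11 P \<Longrightarrow> d11 Q \<Longrightarrow> d11 (\<lambda>e F. P e F \<and> Q e F)"
  unfolding d11_def de_Morgan_conj by (intro conjI s11_conj s11_disj) simp_all

lemma d11_ex:
  "d11 (\<lambda>e F. P (\<lambda>i. e (Suc i)) F (e 0)) \<Longrightarrow> d11 (\<lambda>e F. \<exists>n. P e F n)"
  unfolding d11_def not_ex by (auto intro: s11_ex s11_all)

lemma d11_ar: "ar P \<Longrightarrow> d11 P"
  by (simp add: d11_def s11_ar ar_neg)

lemma d11_ren: "d11 P \<Longrightarrow> inj r \<Longrightarrow> inj q \<Longrightarrow> d11 (\<lambda>e F. P (\<lambda>i. e (r i)) (\<lambda>i. F (q i)))"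
  unfolding d11_def using s11_ren[of P r q] s11_ren[of "\<lambda>e F. \<not> P e F" r q] by blast

interpretation d11: arith_closed d11
  by unfold_locales (fact d11_ar d11_neg d11_conj d11_ex d11_ren)+

abbreviation df :: "functional \<Rightarrow> bool" where "df \<equiv> d11.fn"

text \<open>In normal form the substitution only touches an arithmetical matrix, where Delta-1-1
  data give a Delta-1-1 predicate; the function quantifier is then put back.\<close>

lemma s11_sub:
  assumes "s11 P" "\<And>i. df (t i)" "\<And>i. df (\<lambda>e F. G i (\<lambda>j. e (Suc j)) F (e 0))"
  shows "s11 (\<lambda>e F. P (\<lambda>i. t i e F) (\<lambda>i. G i e F))"
proof -
  obtain Q where Q: "ar Q" "\<And>e F. P e F \<longleftrightarrow> (\<exists>f. Q e (case_nat f F))"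
    using s11_normal[OF assms(1)] by blast
  define H where "H i e F = (case i of 0 \<Rightarrow> F 0 | Suc j \<Rightarrow> G j e (\<lambda>i. F (Suc i)))"
    for i e and F :: "nat \<Rightarrow> nat \<Rightarrow> nat"
  have "d11 (\<lambda>e F. Q (\<lambda>i. t i e (\<lambda>i. F (Suc i))) (\<lambda>i. H i e F))"
  proof (rule d11.K_sub[OF Q(1)])
    fix i
    show "df (\<lambda>e F. t i e (\<lambda>i. F (Suc i)))"
      using d11.fn_ren[OF assms(2) inj_on_id inj_Suc] by simp
    show "df (\<lambda>e F. H i (\<lambda>j. e (Suc j)) F (e 0))"
    proof (cases i)
      case (Suc j)
      then show ?thesis using d11.fn_ren[OF assms(3)[of j] inj_on_id inj_Suc] by (simp add: H_def)
    qed (simp add: H_def d11.fn_fapp d11.fn_var)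
  qed
  moreover have "(\<lambda>i. H i e F) = case_nat (F 0) (\<lambda>i. G i e (\<lambda>i. F (Suc i)))" for e F
    by (auto simp: H_def fun_eq_iff split: nat.splits)
  ultimately have "s11 (\<lambda>e F. Q (\<lambda>i. t i e (\<lambda>i. F (Suc i))) (case_nat (F 0) (\<lambda>i. G i e (\<lambda>i. F (Suc i)))))"
    by (simp add: d11_def)
  from s11_exf[where P = "\<lambda>e F f. Q (\<lambda>i. t i e F) (case_nat f (\<lambda>i. G i e F))", OF this]
  show ?thesis by (simp add: Q(2))
qed

lemma d11_sub:
  assumes "d11 P" "\<And>i. df (t i)" "\<And>i. df (\<lambda>e F. G i (\<lambda>j. e (Suc j)) F (e 0))"
  shows "d11 (\<lambda>e F. P (\<lambda>i. t i e F) (\<lambda>i. G i e F))"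
  using assms s11_sub unfolding d11_def by force

section \<open>Pi-1-1 predicates and rules for recognizing definability\<close>

definition p11 :: "predicate \<Rightarrow> bool" where
  "p11 P \<longleftrightarrow> s11 (\<lambda>e F. \<not> P e F)"

text \<open>Definability proofs peel off connectives by \<open>s11_rules\<close> until polarity no
  longer matters, and settle the Delta-1-1 leaves by \<open>definable\<close>.\<close>

named_theorems definable and s11_rules

lemma df_var [definable]: "df (\<lambda>e F. e i)"
  by (rule d11.fn_var)

lemma df_const [definable]: "df (\<lambda>e F. c)"
  by (induction c) (auto intro: d11.fn_zero d11.fn_Suc)

lemmas [definable] = d11.fn_Suc d11.fn_plus d11.fn_times d11.fn_fapp d11.fn_prod_encode
  d11.K_eq d11.K_less d11_neg d11_conj d11_ex

lemma d11_disj [definable]: "d11 P \<Longrightarrow> d11 Q \<Longrightarrow> d11 (\<lambda>e F. P e F \<or> Q e F)"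
  using d11_neg[OF d11_conj[OF d11_neg d11_neg]] by simp

lemma d11_imp [definable]: "d11 P \<Longrightarrow> d11 Q \<Longrightarrow> d11 (\<lambda>e F. P e F \<longrightarrow> Q e F)"
  unfolding imp_conv_disj by (intro d11_disj d11_neg)

lemma d11_iff [definable]: "d11 P \<Longrightarrow> d11 Q \<Longrightarrow> d11 (\<lambda>e F. P e F \<longleftrightarrow> Q e F)"
  unfolding iff_conv_conj_imp by (intro d11_conj d11_imp)

lemma d11_all [definable]:
  "d11 (\<lambda>e F. P (\<lambda>i. e (Suc i)) F (e 0)) \<Longrightarrow> d11 (\<lambda>e F. \<forall>n. P e F n)"
  using d11_neg[OF d11_ex[where P = "\<lambda>e F n. \<not> P e F n", OF d11_neg]] by simp

lemma d11_le [definable]: "df t \<Longrightarrow> df u \<Longrightarrow> d11 (\<lambda>e F. t e F \<le> u e F)"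
  using d11_neg[OF d11.K_less] by (simp add: not_less)

lemma d11_s11: "d11 P \<Longrightarrow> s11 P" and d11_p11: "d11 P \<Longrightarrow> p11 P"
  by (simp_all add: d11_def p11_def)

lemmas [s11_rules] = s11_conj s11_disj s11_ex s11_all s11_exf

lemma s11_not [s11_rules]: "p11 P \<Longrightarrow> s11 (\<lambda>e F. \<not> P e F)"
  by (simp add: p11_def)

lemma p11_not [s11_rules]: "s11 P \<Longrightarrow> p11 (\<lambda>e F. \<not> P e F)"
  by (simp add: p11_def)

lemma p11_conj [s11_rules]: "p11 P \<Longrightarrow> p11 Q \<Longrightarrow> p11 (\<lambda>e F. P e F \<and> Q e F)"
  unfolding p11_def de_Morgan_conj by (rule s11_disj)

lemma p11_disj [s11_rules]: "p11 P \<Longrightarrow> p11 Q \<Longrightarrow> p11 (\<lambda>e F. P e F \<or> Q e F)"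
  unfolding p11_def de_Morgan_disj by (rule s11_conj)

lemma p11_ex [s11_rules]:
  "p11 (\<lambda>e F. P (\<lambda>i. e (Suc i)) F (e 0)) \<Longrightarrow> p11 (\<lambda>e F. \<exists>n. P e F n)"
  unfolding p11_def not_ex by (rule s11_all)

lemma p11_all [s11_rules]:
  "p11 (\<lambda>e F. P (\<lambda>i. e (Suc i)) F (e 0)) \<Longrightarrow> p11 (\<lambda>e F. \<forall>n. P e F n)"
  unfolding p11_def not_all by (rule s11_ex)

lemma s11_imp [s11_rules]: "p11 P \<Longrightarrow> s11 Q \<Longrightarrow> s11 (\<lambda>e F. P e F \<longrightarrow> Q e F)"
  unfolding p11_def imp_conv_disj by (rule s11_disj)

lemma p11_imp [s11_rules]: "s11 P \<Longrightarrow> p11 Q \<Longrightarrow> p11 (\<lambda>e F. P e F \<longrightarrow> Q e F)"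
  unfolding imp_conv_disj by (intro p11_disj p11_not)

text \<open>A total function misses a value exactly when it takes another one, so a Sigma-1-1 graph
  has a Sigma-1-1 complement.\<close>

lemma df_of_s11_graph:
  assumes "s11 (\<lambda>e F. t (\<lambda>i. e (Suc i)) F = e 0)"
  shows "df t"
proof -
  have "s11 (\<lambda>e F. \<exists>m. t (\<lambda>i. e (Suc i)) F = m \<and> m \<noteq> e 0)"
  proof (intro s11_ex s11_conj)
    have "inj (case_nat 0 (\<lambda>i. Suc (Suc i)))" by (auto simp: inj_def split: nat.splits)
    from s11_ren[OF assms this inj_on_id]
    show "s11 (\<lambda>e F. t (\<lambda>i. e (Suc (Suc i))) F = e 0)" by simp
  qed (intro d11_s11 definable)
  then show ?thesis using assms by (simp add: d11.fn_def d11_def)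
qed

lemma df_sub1:
  assumes "df (\<lambda>e F. f (e 0))" "df t"
  shows "df (\<lambda>e F. f (t e F))"
  using d11.fn_app[where G = "\<lambda>e F. f"] assms by blast

lemmas df_sub2 = d11.fn_sub2

lemma s11_sub1: "s11 (\<lambda>e F. P (e 0)) \<Longrightarrow> df t \<Longrightarrow> s11 (\<lambda>e F. P (t e F))"
  using s11_sub[where P = "\<lambda>e F. P (e 0)" and t = "\<lambda>i. t" and G = "\<lambda>i e F. F i"] by (simp add: definable)

lemma d11_sub2:
  "d11 (\<lambda>e F. P (e 0) (e (Suc 0))) \<Longrightarrow> df t \<Longrightarrow> df u \<Longrightarrow> d11 (\<lambda>e F. P (t e F) (u e F))"
  using d11_sub[where P = "\<lambda>e F. P (e 0) (e (Suc 0))" and t = "\<lambda>i. if i = 0 then t else u" and G = "\<lambda>i e F. F i"] by (simp add: definable)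

lemma s11_sub2:
  "s11 (\<lambda>e F. P (e 0) (e (Suc 0))) \<Longrightarrow> df t \<Longrightarrow> df u \<Longrightarrow> s11 (\<lambda>e F. P (t e F) (u e F))"
  using s11_sub[where P = "\<lambda>e F. P (e 0) (e (Suc 0))" and t = "\<lambda>i. if i = 0 then t else u" and G = "\<lambda>i e F. F i"] by (simp add: definable)

lemma p11_sub1: "p11 (\<lambda>e F. P (e 0)) \<Longrightarrow> df t \<Longrightarrow> p11 (\<lambda>e F. P (t e F))"
  unfolding p11_def by (rule s11_sub1)

lemma p11_sub2:
  "p11 (\<lambda>e F. P (e 0) (e (Suc 0))) \<Longrightarrow> df t \<Longrightarrow> df u \<Longrightarrow> p11 (\<lambda>e F. P (t e F) (u e F))"
  unfolding p11_def by (rule s11_sub2)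

lemma d11_sub3:
  "d11 (\<lambda>e F. P (e 0) (e (Suc 0)) (e (Suc (Suc 0)))) \<Longrightarrow> df t \<Longrightarrow> df u \<Longrightarrow> df v \<Longrightarrow>
    d11 (\<lambda>e F. P (t e F) (u e F) (v e F))"
  using d11_sub[where P = "\<lambda>e F. P (e 0) (e (Suc 0)) (e (Suc (Suc 0)))" and t = "\<lambda>i. if i = 0 then t else if i = Suc 0 then u else v" and G = "\<lambda>i e F. F i"]
  by (simp add: definable)

text \<open>
  Iteration is definable because a function quantifier can guess the whole sequence of iterates;
  this replaces any arithmetical coding of recursion.
\<close>

lemma df_funpow:
  assumes "df (\<lambda>e F. f (e 0))" "df t" "df u"
  shows "df (\<lambda>e F. (f ^^ t e F) (u e F))"
proof -
  have iter: "(\<exists>h. h 0 = x \<and> (\<forall>k. h (Suc k) = f (h k)) \<and> h n = y) \<longleftrightarrow> (f ^^ n) x = y" for x n y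
  proof
    assume "\<exists>h. h 0 = x \<and> (\<forall>k. h (Suc k) = f (h k)) \<and> h n = y"
    then obtain h where h: "h 0 = x" "\<And>k. h (Suc k) = f (h k)" "h n = y" by blast
    have "h k = (f ^^ k) x" for k by (induction k) (simp_all add: h)
    with h(3) show "(f ^^ n) x = y" by simp
  qed (auto intro!: exI[of _ "\<lambda>k. (f ^^ k) x"])
  have "df (\<lambda>e F. (f ^^ e 0) (e (Suc 0)))"
    by (rule df_of_s11_graph, unfold iter[symmetric], intro s11_rules)
      (intro d11_s11 definable df_sub1[OF assms(1)])+
  then show ?thesis by (rule df_sub2) (fact assms)+
qed

lemma df_power2 [definable]: "df t \<Longrightarrow> df (\<lambda>e F. 2 ^ t e F)"
proof -
  have "2 ^ n = ((\<lambda>k. k + k) ^^ n) (1 :: nat)" for n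
    by (induction n) simp_all
  then show "df t \<Longrightarrow> ?thesis"
    by (simp only:) (intro df_funpow definable)
qed

lemma df_div [definable]:
  assumes "df t" "0 < k" shows "df (\<lambda>e F. t e F div k)"
proof (rule df_sub1[OF _ assms(1)])
  have "n div k = q \<longleftrightarrow> k * q \<le> n \<and> n < k * Suc q" for n q
    using assms(2) by (metis div_nat_eqI mult.commute div_times_less_eq_dividend dividend_less_times_div mult_Suc_right add.commute)
  then show "df (\<lambda>e F. e 0 div k)"
    unfolding d11.fn_def by (simp only:) (intro definable)
qed

lemma df_mod [definable]:
  assumes "df t" "0 < k" shows "df (\<lambda>e F. t e F mod k)"
proof (rule df_sub1[OF _ assms(1)])
  have "n mod k = r \<longleftrightarrow> r + k * (n div k) = n" for n r
    by (metis add_right_cancel mod_mult_div_eq)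
  then show "df (\<lambda>e F. e 0 mod k)"
    unfolding d11.fn_def by (simp only:) (intro definable assms(2))
qed

abbreviation pfst :: "nat \<Rightarrow> nat" where "pfst z \<equiv> fst (prod_decode z)"
abbreviation psnd :: "nat \<Rightarrow> nat" where "psnd z \<equiv> snd (prod_decode z)"

lemma df_pfst [definable]: "df t \<Longrightarrow> df (\<lambda>e F. pfst (t e F))"
proof (erule df_sub1[rotated])
  have "pfst z = a \<longleftrightarrow> (\<exists>b. prod_encode (a, b) = z)" for a z
    by (metis fst_conv prod.collapse prod_decode_inverse prod_encode_inverse)
  then show "df (\<lambda>e F. pfst (e 0))"
    unfolding d11.fn_def by (simp only:) (intro definable)
qed

lemma df_psnd [definable]: "df t \<Longrightarrow> df (\<lambda>e F. psnd (t e F))"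
proof (erule df_sub1[rotated])
  have "psnd z = b \<longleftrightarrow> (\<exists>a. prod_encode (a, b) = z)" for b z
    by (metis snd_conv prod.collapse prod_decode_inverse prod_encode_inverse)
  then show "df (\<lambda>e F. psnd (e 0))"
    unfolding d11.fn_def by (simp only:) (intro definable)
qed

section \<open>Number codes of strings\<close>

definition lenc :: "nat \<Rightarrow> nat" where
  "lenc c = length (list_decode c)"

text \<open>The default 0 past the end lets a code serve as a total assignment of number
  variables.\<close>

definition nthc :: "nat \<Rightarrow> nat \<Rightarrow> nat" where
  "nthc c i = (if i < lenc c then list_decode c ! i else 0)"

definition tlc :: "nat \<Rightarrow> nat" where
  "tlc c = list_encode (tl (list_decode c))"

lemma df_tlc: "df t \<Longrightarrow> df (\<lambda>e F. tlc (t e F))"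
proof (erule df_sub1[rotated])
  have "tlc c = d \<longleftrightarrow> (c = 0 \<and> d = 0) \<or> (\<exists>a. c = Suc (prod_encode (a, d)))" for c d
  proof (cases "list_decode c")
    case Nil
    then have "c = 0" by (metis list_decode_inverse list_encode.simps(1))
    then show ?thesis by (auto simp: tlc_def)
  next
    case (Cons a xs)
    then have "c = Suc (prod_encode (a, list_encode xs))"
      by (metis list_decode_inverse list_encode.simps(2))
    then show ?thesis by (auto simp: tlc_def)
  qed
  then show "df (\<lambda>e F. tlc (e 0))"
    unfolding d11.fn_def by (simp only:) (intro definable)
qed

lemma tlc_funpow: "(tlc ^^ n) c = list_encode (drop n (list_decode c))"
  by (induction n) (simp_all add: tlc_def tl_drop drop_Suc)

lemma list_encode_eq_0: "list_encode xs = 0 \<longleftrightarrow> xs = []"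
  by (cases xs) simp_all

text \<open>Only the empty list has code 0, so length is expressed by iterating \<open>tlc\<close>
  and inherits definability from \<open>df_funpow\<close>.\<close>

lemma lenc_le_iff: "lenc c \<le> n \<longleftrightarrow> (tlc ^^ n) c = 0"
  by (simp add: tlc_funpow list_encode_eq_0 lenc_def)

lemma df_lenc [definable]: "df t \<Longrightarrow> df (\<lambda>e F. lenc (t e F))"
proof (erule df_sub1[rotated])
  have "lenc c = n \<longleftrightarrow> (tlc ^^ n) c = 0 \<and> (\<forall>m. (tlc ^^ m) c = 0 \<longrightarrow> n \<le> m)" for c n
    unfolding lenc_le_iff[symmetric] by (meson dual_order.refl order_antisym order_trans)
  then show "df (\<lambda>e F. lenc (e 0))"
    unfolding d11.fn_def by (simp only:) (intro definable df_funpow df_tlc)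
qed

lemma df_nthc [definable]: "df t \<Longrightarrow> df u \<Longrightarrow> df (\<lambda>e F. nthc (t e F) (u e F))"
proof (erule (1) df_sub2[rotated])
  have "nthc c i = a \<longleftrightarrow> (lenc c \<le> i \<and> a = 0) \<or> (\<exists>d. (tlc ^^ i) c = Suc (prod_encode (a, d)))" for c i a
  proof (cases "i < lenc c")
    case True
    then have "drop i (list_decode c) = list_decode c ! i # drop (Suc i) (list_decode c)"
      by (simp add: Cons_nth_drop_Suc lenc_def)
    with True show ?thesis by (auto simp: nthc_def tlc_funpow)
  qed (auto simp: nthc_def tlc_funpow lenc_def)
  then show "df (\<lambda>e F. nthc (e 0) (e (Suc 0)))"
    unfolding d11.fn_def by (simp only:) (intro definable df_funpow df_tlc)
qed

lemma lenc_encode [simp]: "lenc (list_encode xs) = length xs"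
  by (simp add: lenc_def)

lemma nthc_encode: "nthc (list_encode xs) i = (if i < length xs then xs ! i else 0)"
  by (simp add: nthc_def)

lemma code_eqI: "lenc c = lenc d \<Longrightarrow> (\<And>i. i < lenc c \<Longrightarrow> nthc c i = nthc d i) \<Longrightarrow> c = d"
  by (metis lenc_def list_decode_inverse nth_equalityI nthc_def)

lemma ex_code: "\<exists>c. lenc c = n \<and> (\<forall>i<n. nthc c i = f i)"
  by (rule exI[of _ "list_encode (map f [0..<n])"]) (simp add: nthc_encode)

section \<open>Comparing ranks by simulations\<close>

text \<open>A pair \<open>(x', x)\<close> makes \<open>x'\<close> a child of \<open>x\<close>; every
  descent from \<open>x\<close> is answered by a descent from \<open>y\<close>.\<close>

definition simulation :: "('a \<times> 'a) set \<Rightarrow> ('a \<Rightarrow> 'a \<Rightarrow> bool) \<Rightarrow> bool" where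
  "simulation E Z \<longleftrightarrow>
    (\<forall>x y x'. Z x y \<longrightarrow> (x', x) \<in> E \<longrightarrow> (\<exists>y'. (y', y) \<in> E \<and> Z x' y'))"

definition simulated :: "('a \<times> 'a) set \<Rightarrow> 'a \<Rightarrow> 'a \<Rightarrow> bool" where
  "simulated E a b \<longleftrightarrow> (\<exists>Z. Z a b \<and> simulation E Z)"

lemma simulation_simulated: "simulation E Z \<Longrightarrow> Z a b \<Longrightarrow> simulated E a b"
  unfolding simulated_def by blast

lemma simulatedD:
  assumes "simulated E a b" "(a', a) \<in> E"
  shows "\<exists>b'. (b', b) \<in> E \<and> simulated E a' b'"
proof -
  obtain Z where Z: "Z a b" "simulation E Z" using assms(1) unfolding simulated_def by blast
  then obtain b' where "(b', b) \<in> E" "Z a' b'" using assms(2) unfolding simulation_def by blast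
  with Z(2) show ?thesis by (blast intro: simulation_simulated)
qed

text \<open>\<open>simulated\<close> is the greatest simulation, and adding one pair whose children
  are already matched gives a simulation again.\<close>

lemma simulatedI:
  assumes "\<And>a'. (a', a) \<in> E \<Longrightarrow> \<exists>b'. (b', b) \<in> E \<and> simulated E a' b'"
  shows "simulated E a b"
proof (rule simulation_simulated)
  show "simulation E (\<lambda>x y. x = a \<and> y = b \<or> simulated E x y)"
    unfolding simulation_def using assms simulatedD[of E] by blast
qed simp

lemma simulated_trans:
  assumes "simulated E a b" "simulated E b c"
  shows "simulated E a c"
proof (rule simulation_simulated)
  show "simulation E (\<lambda>x y. \<exists>z. simulated E x z \<and> simulated E z y)"
    unfolding simulation_def using simulatedD[of E] by blast
qed (use assms in blast)

lemma simulated_refl: "simulated E a a"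
  by (rule simulation_simulated[where Z = "(=)"]) (auto simp: simulation_def)

lemma simulated_acc:
  assumes "b \<in> Wellfounded.acc E" "simulated E a b"
  shows "a \<in> Wellfounded.acc E"
  using assms
proof (induction arbitrary: a rule: acc.induct)
  case (accI b)
  show ?case
  proof (rule acc.accI)
    fix a' assume "(a', a) \<in> E"
    then obtain b' where "(b', b) \<in> E" "simulated E a' b'" using simulatedD[OF accI.prems] by blast
    then show "a' \<in> Wellfounded.acc E" using accI.IH by blast
  qed
qed

text \<open>On the well-founded part this is strict inequality of ranks, without mention of
  ordinals.\<close>

definition rank_less :: "('a \<times> 'a) set \<Rightarrow> 'a \<Rightarrow> 'a \<Rightarrow> bool" where
  "rank_less E a b \<longleftrightarrow> (\<exists>b'. (b', b) \<in> E \<and> simulated E a b')"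

lemma rank_less_simulated_trans: "rank_less E a b \<Longrightarrow> simulated E b c \<Longrightarrow> rank_less E a c"
  unfolding rank_less_def by (meson simulated_trans simulatedD)

text \<open>Some child \<open>a'\<close> of \<open>a\<close> is simulated by no child of
  \<open>b\<close>. By induction all children of \<open>b\<close> lie strictly below
  \<open>a'\<close>, so \<open>b\<close> is simulated by \<open>a'\<close>.\<close>

lemma not_simulated_rank_less:
  assumes "b \<in> Wellfounded.acc E" "\<not> simulated E a b"
  shows "rank_less E b a"
  using assms
proof (induction arbitrary: a rule: acc.induct)
  case (accI b)
  obtain a' where a': "(a', a) \<in> E" "\<And>b'. (b', b) \<in> E \<Longrightarrow> \<not> simulated E a' b'"
    using simulatedI[of a E b] accI.prems by blast
  have "simulated E b a'"
    by (rule simulatedI) (use accI.IH a'(2) in \<open>simp add: rank_less_def\<close>)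
  with a'(1) show ?case unfolding rank_less_def by blast
qed

lemma rank_minimal:
  assumes "r c \<in> Wellfounded.acc E" "c \<in> C"
  obtains c0 where "c0 \<in> C" "r c0 \<in> Wellfounded.acc E" "\<And>c'. c' \<in> C \<Longrightarrow> \<not> rank_less E (r c') (r c0)"
proof -
  \<comment> \<open>The induction runs along a bound \<open>y\<close> of the rank instead of along
    \<open>r c\<close>: a candidate of lower rank is simulated by a child of \<open>y\<close> but
    need not be mapped to a child.\<close>
  have "\<exists>c0\<in>C. simulated E (r c0) y \<and> (\<forall>c'\<in>C. \<not> rank_less E (r c') (r c0))"
    if "y \<in> Wellfounded.acc E" "c \<in> C" "simulated E (r c) y" for y c
    using that
  proof (induction arbitrary: c rule: acc.induct)
    case (accI y)
    have y: "y \<in> Wellfounded.acc E" using accI.hyps by (rule acc.accI)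
    show ?case
    proof (cases "\<forall>c'\<in>C. \<not> rank_less E (r c') (r c)")
      case False
      then obtain c' where c': "c' \<in> C" "rank_less E (r c') (r c)" by blast
      then obtain y' where y': "(y', y) \<in> E" "simulated E (r c') y'"
        using rank_less_simulated_trans accI.prems unfolding rank_less_def by metis
      from accI.IH[OF y'(1) c'(1) y'(2)] obtain c0 where c0: "c0 \<in> C" "simulated E (r c0) y'"
        "\<forall>c'\<in>C. \<not> rank_less E (r c') (r c0)" by blast
      have "simulated E (r c0) y"
      proof -
        have "simulated E (r c0) (r c) \<or> rank_less E (r c) (r c0)"
          using not_simulated_rank_less simulated_acc[OF y] accI.prems by metis
        then show ?thesis using c0 accI.prems simulated_trans by metis
      qed
      with c0 show ?thesis by blast
    qed (use accI.prems in blast)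
  qed
  from this[OF assms simulated_refl] that show ?thesis using assms simulated_acc by metis
qed

text \<open>
  \<open>select E C r c\<close> picks the least \<open>c\<close> among the candidates \<open>C\<close> for which \<open>r c\<close> has minimal rank;
  both comparisons are negated so that the condition is \<open>\<Pi>\<^sup>1\<^sub>1\<close>.
\<close>

definition select :: "('a \<times> 'a) set \<Rightarrow> (nat \<Rightarrow> bool) \<Rightarrow> (nat \<Rightarrow> 'a) \<Rightarrow> nat \<Rightarrow> bool" where
  "select E C r c \<longleftrightarrow> C c \<and> r c \<in> Wellfounded.acc E \<and>
    (\<forall>c'. C c' \<longrightarrow> \<not> rank_less E (r c') (r c) \<and> (c' < c \<longrightarrow> \<not> simulated E (r c') (r c)))"

text \<open>If \<open>c < d\<close>, the selection of \<open>d\<close> forbids \<open>r d\<close> to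
  simulate \<open>r c\<close>; then \<open>r d\<close> has the smaller rank, against the minimality
  of \<open>c\<close>.\<close>

lemma select_unique:
  assumes "select E C r c" "select E C r d" shows "c = d"
proof -
  have "\<not> c < d" if "select E C r c" "select E C r d" for c d
    using that not_simulated_rank_less[of "r d" E "r c"] unfolding select_def by blast
  with assms show ?thesis by (meson linorder_neqE_nat)
qed

lemma select_exists:
  assumes "C c" "r c \<in> Wellfounded.acc E"
  shows "\<exists>c. select E C r c"
proof -
  define M where "M c \<longleftrightarrow> C c \<and> r c \<in> Wellfounded.acc E \<and> (\<forall>c'. C c' \<longrightarrow> \<not> rank_less E (r c') (r c))" for c
  obtain c0 where "M c0"
    using rank_minimal[of r c E "Collect C"] assms unfolding M_def by auto
  define m where "m = (LEAST c. M c)"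
  have m: "M m" unfolding m_def using \<open>M c0\<close> by (rule LeastI)
  \<comment> \<open>A smaller candidate simulated by \<open>r m\<close> would have minimal rank as
    well, against the choice of \<open>m\<close>.\<close>
  have "\<not> simulated E (r c) (r m)" if "C c" "c < m" for c
  proof
    assume s: "simulated E (r c) (r m)"
    have "M c" unfolding M_def
    proof (intro conjI allI impI)
      show "r c \<in> Wellfounded.acc E" using s m simulated_acc unfolding M_def by metis
      fix c' assume "C c'"
      then show "\<not> rank_less E (r c') (r c)"
        using m s rank_less_simulated_trans unfolding M_def by metis
    qed (fact that)
    then show False using that(2) not_less_Least unfolding m_def by blast
  qed
  with m show ?thesis unfolding select_def M_def by blast
qed

section \<open>A universal well-founded part\<close>

lemma pfst_le: "pfst z \<le> z" and psnd_le: "psnd z \<le> z"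
  by (metis le_prod_encode_1 prod.collapse prod_decode_inverse)
     (metis le_prod_encode_2 prod.collapse prod_decode_inverse)

lemma tm_code_less: "z mod 6 \<noteq> 0 \<Longrightarrow> z div 6 < (z :: nat)"
  by (cases "z = 0") auto

lemma fm_code_less: "z mod 5 \<noteq> 0 \<Longrightarrow> z div 5 < (z :: nat)"
  by (cases "z = 0") auto

function decode_tm :: "nat \<Rightarrow> tm" where
  "decode_tm z =
    (if z mod 6 = 0 then NVar (z div 6)
     else if z mod 6 = 1 then Zero
     else if z mod 6 = 2 then Succ (decode_tm (z div 6))
     else if z mod 6 = 3 then Plus (decode_tm (pfst (z div 6))) (decode_tm (psnd (z div 6)))
     else if z mod 6 = 4 then Times (decode_tm (pfst (z div 6))) (decode_tm (psnd (z div 6)))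
     else FApp (pfst (z div 6)) (decode_tm (psnd (z div 6))))"
  by pat_completeness auto
termination
  by (relation "Wellfounded.measure id")
    (auto simp: tm_code_less intro: le_less_trans[OF pfst_le] le_less_trans[OF psnd_le])

text \<open>Every number decodes, so no well-formedness test arises. \<open>ExF\<close> gets no code
  because only arithmetical matrices are to be coded.\<close>

function decode_fm :: "nat \<Rightarrow> fm" where
  "decode_fm z =
    (if z mod 5 = 0 then Equal (decode_tm (pfst (z div 5))) (decode_tm (psnd (z div 5)))
     else if z mod 5 = 1 then Less (decode_tm (pfst (z div 5))) (decode_tm (psnd (z div 5)))
     else if z mod 5 = 2 then Neg (decode_fm (z div 5))
     else if z mod 5 = 3 then And (decode_fm (pfst (z div 5))) (decode_fm (psnd (z div 5)))
     else ExN (pfst (z div 5)) (decode_fm (psnd (z div 5))))"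
  by pat_completeness auto
termination
  by (relation "Wellfounded.measure id")
    (auto simp: fm_code_less intro: le_less_trans[OF pfst_le] le_less_trans[OF psnd_le])

declare decode_tm.simps [simp del] decode_fm.simps [simp del]

lemma decode_tm_eq:
  "k < 6 \<Longrightarrow> decode_tm (6 * z + k) =
    (if k = 0 then NVar z else if k = 1 then Zero else if k = 2 then Succ (decode_tm z)
     else if k = 3 then Plus (decode_tm (pfst z)) (decode_tm (psnd z))
     else if k = 4 then Times (decode_tm (pfst z)) (decode_tm (psnd z))
     else FApp (pfst z) (decode_tm (psnd z)))"
proof -
  assume "k < 6"
  then have "(6 * z + k) mod 6 = k" "(6 * z + k) div 6 = z" by simp_all
  then show ?thesis by (subst decode_tm.simps) (simp only:)
qed

lemma decode_fm_eq:
  "k < 5 \<Longrightarrow> decode_fm (5 * z + k) =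
    (if k = 0 then Equal (decode_tm (pfst z)) (decode_tm (psnd z))
     else if k = 1 then Less (decode_tm (pfst z)) (decode_tm (psnd z))
     else if k = 2 then Neg (decode_fm z)
     else if k = 3 then And (decode_fm (pfst z)) (decode_fm (psnd z))
     else ExN (pfst z) (decode_fm (psnd z)))"
proof -
  assume "k < 5"
  then have "(5 * z + k) mod 5 = k" "(5 * z + k) div 5 = z" by simp_all
  then show ?thesis by (subst decode_fm.simps) (simp only:)
qed

lemma decode_tm_surj: "\<exists>z. decode_tm z = t"
proof (induction t)
  case (NVar i)
  show ?case using decode_tm_eq[of 0 i] by auto
next
  case Zero
  show ?case using decode_tm_eq[of 1] by (intro exI) auto
next
  case (Succ t)
  then obtain z where "decode_tm z = t" by blast
  then show ?case using decode_tm_eq[of 2 z] by (intro exI) auto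
next
  case (Plus s t)
  then obtain y z where "decode_tm y = s" "decode_tm z = t" by blast
  then show ?case using decode_tm_eq[of 3 "prod_encode (y, z)"] by (intro exI) auto
next
  case (Times s t)
  then obtain y z where "decode_tm y = s" "decode_tm z = t" by blast
  then show ?case using decode_tm_eq[of 4 "prod_encode (y, z)"] by (intro exI) auto
next
  case (FApp i t)
  then obtain z where "decode_tm z = t" by blast
  then show ?case using decode_tm_eq[of 5 "prod_encode (i, z)"] by (intro exI) auto
qed

lemma decode_fm_surj: "arithmetical p \<Longrightarrow> \<exists>z. decode_fm z = p"
proof (induction p)
  case (Equal s t)
  obtain y z where "decode_tm y = s" "decode_tm z = t" using decode_tm_surj by meson
  then show ?case using decode_fm_eq[of 0 "prod_encode (y, z)"] by (intro exI) auto
next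
  case (Less s t)
  obtain y z where "decode_tm y = s" "decode_tm z = t" using decode_tm_surj by meson
  then show ?case using decode_fm_eq[of 1 "prod_encode (y, z)"] by (intro exI) auto
next
  case (Neg p)
  then obtain z where "decode_fm z = p" by auto
  then show ?case using decode_fm_eq[of 2 z] by (intro exI) auto
next
  case (And p q)
  then obtain y z where "decode_fm y = p" "decode_fm z = q" by auto
  then show ?case using decode_fm_eq[of 3 "prod_encode (y, z)"] by (intro exI) auto
next
  case (ExN i p)
  then obtain z where "decode_fm z = p" by auto
  then show ?case using decode_fm_eq[of 4 "prod_encode (i, z)"] by (intro exI) auto
qed simp

section \<open>Tarskian valuations\<close>

abbreviation pr :: "nat \<Rightarrow> nat \<Rightarrow> nat" where "pr a b \<equiv> prod_encode (a, b)"

text \<open>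
  A function \<open>h\<close> records a valuation at tagged positions: \<open>pr 0 (pr i n)\<close> holds the value of
  function variable \<open>i\<close> at \<open>n\<close>, \<open>pr 1 (pr z c)\<close> the value of the term coded by \<open>z\<close> in the
  environment coded by the list \<open>c\<close>, and \<open>pr 2 (pr z c)\<close> is positive iff the formula coded by
  \<open>z\<close> is true there, in which case it is the successor of a witness if that formula is existential.
  Every Tarski clause relates at most three values \<open>u\<close>, \<open>v\<close>, \<open>w\<close>, at positions \<open>a\<close>, \<open>b\<close>, \<open>d\<close>,
  so the correct valuations form a closed set.
\<close>

definition tarski_tm :: "nat \<Rightarrow> nat \<Rightarrow> nat \<Rightarrow> nat \<Rightarrow> nat \<Rightarrow> nat \<Rightarrow> bool" where
  "tarski_tm a b d u v w \<longleftrightarrow> (\<forall>z c. a = pr 1 (pr z c) \<longrightarrow>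
     (z mod 6 = 0 \<longrightarrow> u = nthc c (z div 6)) \<and>
     (z mod 6 = 1 \<longrightarrow> u = 0) \<and>
     (z mod 6 = 2 \<and> b = pr 1 (pr (z div 6) c) \<longrightarrow> u = Suc v) \<and>
     (z mod 6 = 3 \<and> b = pr 1 (pr (pfst (z div 6)) c) \<and> d = pr 1 (pr (psnd (z div 6)) c) \<longrightarrow> u = v + w) \<and>
     (z mod 6 = 4 \<and> b = pr 1 (pr (pfst (z div 6)) c) \<and> d = pr 1 (pr (psnd (z div 6)) c) \<longrightarrow> u = v * w) \<and>
     (z mod 6 = 5 \<and> b = pr 1 (pr (psnd (z div 6)) c) \<and> d = pr 0 (pr (pfst (z div 6)) v) \<longrightarrow> u = w))"

definition tarski_fm :: "nat \<Rightarrow> nat \<Rightarrow> nat \<Rightarrow> nat \<Rightarrow> nat \<Rightarrow> nat \<Rightarrow> bool" where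
  "tarski_fm a b d u v w \<longleftrightarrow> (\<forall>z c. a = pr 2 (pr z c) \<longrightarrow>
     (z mod 5 = 0 \<and> b = pr 1 (pr (pfst (z div 5)) c) \<and> d = pr 1 (pr (psnd (z div 5)) c) \<longrightarrow> (0 < u \<longleftrightarrow> v = w)) \<and>
     (z mod 5 = 1 \<and> b = pr 1 (pr (pfst (z div 5)) c) \<and> d = pr 1 (pr (psnd (z div 5)) c) \<longrightarrow> (0 < u \<longleftrightarrow> v < w)) \<and>
     (z mod 5 = 2 \<and> b = pr 2 (pr (z div 5) c) \<longrightarrow> (0 < u \<longleftrightarrow> v = 0)) \<and>
     (z mod 5 = 3 \<and> b = pr 2 (pr (pfst (z div 5)) c) \<and> d = pr 2 (pr (psnd (z div 5)) c) \<longrightarrow> (0 < u \<longleftrightarrow> 0 < v \<and> 0 < w)) \<and>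
     (\<forall>c' n. z mod 5 = 4 \<and> b = pr 2 (pr (psnd (z div 5)) c') \<and>
        (\<forall>j. (j = pfst (z div 5) \<longrightarrow> nthc c' j = n) \<and> (j \<noteq> pfst (z div 5) \<longrightarrow> nthc c' j = nthc c j)) \<longrightarrow>
        (u = 0 \<longrightarrow> v = 0) \<and> (u = Suc n \<longrightarrow> 0 < v)))"

definition tarski :: "nat \<Rightarrow> nat \<Rightarrow> nat \<Rightarrow> nat \<Rightarrow> nat \<Rightarrow> nat \<Rightarrow> bool" where
  "tarski a b d u v w \<longleftrightarrow> tarski_tm a b d u v w \<and> tarski_fm a b d u v w"

definition valuation :: "(nat \<Rightarrow> nat) \<Rightarrow> bool" where
  "valuation h \<longleftrightarrow> (\<forall>a b d. tarski a b d (h a) (h b) (h d))"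

text \<open>The code is lengthened when \<open>i\<close> lies beyond its end; positions in between
  receive 0, in agreement with the default.\<close>

lemma nthc_upd:
  obtains c' where "nthc c' = (nthc c)(i := n)"
proof -
  obtain c' where c': "lenc c' = max (lenc c) (Suc i)"
    "\<forall>j<max (lenc c) (Suc i). nthc c' j = ((nthc c)(i := n)) j"
    using ex_code by blast
  have "nthc c' j = ((nthc c)(i := n)) j" for j
    using c' by (cases "j < max (lenc c) (Suc i)") (auto simp: nthc_def)
  then show ?thesis using that by blast
qed

lemma valuation_tm:
  assumes "valuation h"
  shows "h (pr 1 (pr z c)) = tm_val (nthc c) (\<lambda>i n. h (pr 0 (pr i n))) (decode_tm z)"
proof (induction z rule: decode_tm.induct)
  case (1 z)
  have T: "tarski_tm (pr 1 (pr z c)) b d (h (pr 1 (pr z c))) (h b) (h d)" for b d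
    using assms by (simp add: valuation_def tarski_def)
  have "z mod 6 = 0 \<or> z mod 6 = 1 \<or> z mod 6 = 2 \<or> z mod 6 = 3 \<or> z mod 6 = 4 \<or> z mod 6 = 5"
    by presburger
  then consider "z mod 6 = 0" | "z mod 6 = 1" | "z mod 6 = 2" | "z mod 6 = 3" | "z mod 6 = 4" | "z mod 6 = 5"
    by metis
  then show ?case
  proof cases
    case 1
    then show ?thesis using T by (simp add: tarski_tm_def decode_tm.simps[of z])
  next
    case 2
    then show ?thesis using T by (simp add: tarski_tm_def decode_tm.simps[of z])
  next
    case 3
    then show ?thesis using T[of "pr 1 (pr (z div 6) c)"] 1
      by (simp add: tarski_tm_def decode_tm.simps[of z])
  next
    case 4
    then show ?thesis using T[of "pr 1 (pr (pfst (z div 6)) c)" "pr 1 (pr (psnd (z div 6)) c)"] 1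
      by (simp add: tarski_tm_def decode_tm.simps[of z])
  next
    case 5
    then show ?thesis using T[of "pr 1 (pr (pfst (z div 6)) c)" "pr 1 (pr (psnd (z div 6)) c)"] 1
      by (simp add: tarski_tm_def decode_tm.simps[of z])
  next
    case 6
    \<comment> \<open>The third position depends on the value \<open>h b\<close> of the argument
      term, since the function is looked up there.\<close>
    define b where "b = pr 1 (pr (psnd (z div 6)) c)"
    show ?thesis using T[of b "pr 0 (pr (pfst (z div 6)) (h b))"] 1 6
      by (simp add: tarski_tm_def decode_tm.simps[of z] b_def)
  qed
qed

lemma valuation_fm:
  assumes "valuation h"
  shows "0 < h (pr 2 (pr z c)) \<longleftrightarrow> sat (nthc c) (\<lambda>i n. h (pr 0 (pr i n))) (decode_fm z)"
proof (induction z arbitrary: c rule: decode_fm.induct)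
  case (1 z)
  have T: "tarski_fm (pr 2 (pr z c)) b d (h (pr 2 (pr z c))) (h b) (h d)" for b d
    using assms by (simp add: valuation_def tarski_def)
  note tm = valuation_tm[OF assms, unfolded One_nat_def]
  have "z mod 5 = 0 \<or> z mod 5 = 1 \<or> z mod 5 = 2 \<or> z mod 5 = 3 \<or> z mod 5 = 4"
    by presburger
  then consider "z mod 5 = 0" | "z mod 5 = 1" | "z mod 5 = 2" | "z mod 5 = 3" | "z mod 5 = 4"
    by metis
  then show ?case
  proof cases
    case 1
    then show ?thesis using T[of "pr 1 (pr (pfst (z div 5)) c)" "pr 1 (pr (psnd (z div 5)) c)"]
      by (simp add: tarski_fm_def decode_fm.simps[of z] tm)
  next
    case 2
    then show ?thesis using T[of "pr 1 (pr (pfst (z div 5)) c)" "pr 1 (pr (psnd (z div 5)) c)"]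
      by (simp add: tarski_fm_def decode_fm.simps[of z] tm)
  next
    case 3
    then show ?thesis using T[of "pr 2 (pr (z div 5) c)"] 1
      by (simp add: tarski_fm_def decode_fm.simps[of z]) (metis neq0_conv)
  next
    case 4
    then show ?thesis using T[of "pr 2 (pr (pfst (z div 5)) c)" "pr 2 (pr (psnd (z div 5)) c)"] 1
      by (simp add: tarski_fm_def decode_fm.simps[of z])
  next
    case 5
    define i where "i = pfst (z div 5)"
    define F where "F = (\<lambda>i n. h (pr 0 (pr i n)))"
    define p where "p = decode_fm (psnd (z div 5))"
    let ?u = "h (pr 2 (pr z c))"
    have p: "decode_fm z = ExN i p" using 5 by (simp add: decode_fm.simps[of z] i_def p_def)
    \<comment> \<open>The stored witness makes the existential clause local: value 0 refutes every
      instance, and value \<open>Suc n\<close> confirms instance \<open>n\<close>.\<close>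
    have clause: "(?u = 0 \<longrightarrow> \<not> sat ((nthc c)(i := n)) F p) \<and> (?u = Suc n \<longrightarrow> sat ((nthc c)(i := n)) F p)" for n
    proof -
      obtain c' where c': "nthc c' = (nthc c)(i := n)" by (rule nthc_upd)
      have "0 < h (pr 2 (pr (psnd (z div 5)) c')) \<longleftrightarrow> sat ((nthc c)(i := n)) F p"
        using 1 5 by (simp add: F_def p_def c'[symmetric])
      moreover have "\<forall>j. (j = pfst (z div 5) \<longrightarrow> nthc c' j = n) \<and> (j \<noteq> pfst (z div 5) \<longrightarrow> nthc c' j = nthc c j)"
        by (simp add: c' i_def)
      then have "(?u = 0 \<longrightarrow> h (pr 2 (pr (psnd (z div 5)) c')) = 0) \<and> (?u = Suc n \<longrightarrow> 0 < h (pr 2 (pr (psnd (z div 5)) c')))"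
        using T[of "pr 2 (pr (psnd (z div 5)) c')"] 5 unfolding tarski_fm_def by blast
      ultimately show ?thesis by auto
    qed
    show ?thesis unfolding p F_def[symmetric] sat.simps
      by (metis clause gr0_conv_Suc neq0_conv)
  qed
qed

lemma valuation_exists:
  fixes F :: "nat \<Rightarrow> nat \<Rightarrow> nat"
  obtains h where "valuation h" "\<And>i n. h (pr 0 (pr i n)) = F i n"
proof -
  \<comment> \<open>A bare truth value would not do for existential formulas: the clause for them
    reads a witness off the value.\<close>
  define truth where "truth z c =
    (case decode_fm z of
       ExN i p \<Rightarrow> if sat (nthc c) F (decode_fm z) then Suc (SOME n. sat ((nthc c)(i := n)) F p) else 0
     | p \<Rightarrow> of_bool (sat (nthc c) F p))" for z c
  define h where "h k = (case prod_decode k of (k, l) \<Rightarrow> case prod_decode l of (z, c) \<Rightarrow>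
     if k = 0 then F z c else if k = 1 then tm_val (nthc c) F (decode_tm z) else truth z c)" for k
  have h: "h (pr 0 (pr i n)) = F i n" "h (pr (Suc 0) (pr z c)) = tm_val (nthc c) F (decode_tm z)"
    "h (pr 2 (pr z c)) = truth z c" for i n z c
    by (simp_all add: h_def)
  have truth: "0 < truth z c \<longleftrightarrow> sat (nthc c) F (decode_fm z)" for z c
    by (simp add: truth_def split: fm.split)
  then have truth0: "truth z c = 0 \<longleftrightarrow> \<not> sat (nthc c) F (decode_fm z)" for z c
    by (metis neq0_conv)
  have "tarski_tm a b d (h a) (h b) (h d)" for a b d
    unfolding tarski_tm_def by (auto simp: h decode_tm.simps)
  moreover have "tarski_fm a b d (h a) (h b) (h d)" for a b d
    unfolding tarski_fm_def
  proof (intro allI impI)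
    fix z c assume a: "a = pr 2 (pr z c)"
    let ?i = "pfst (z div 5)" and ?p = "decode_fm (psnd (z div 5))"
    have "(h a = 0 \<longrightarrow> h b = 0) \<and> (h a = Suc n \<longrightarrow> 0 < h b)"
      if "z mod 5 = 4" and b: "b = pr 2 (pr (psnd (z div 5)) c')"
        and "\<forall>j. (j = ?i \<longrightarrow> nthc c' j = n) \<and> (j \<noteq> ?i \<longrightarrow> nthc c' j = nthc c j)" for c' n
    proof -
      have c': "nthc c' = (nthc c)(?i := n)" using that(3) by (auto simp: fun_eq_iff)
      have z: "decode_fm z = ExN ?i ?p" using that(1) by (simp add: decode_fm.simps[of z])
      have "sat ((nthc c)(?i := (SOME n. sat ((nthc c)(?i := n)) F ?p))) F ?p"
        if "sat (nthc c) F (decode_fm z)"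
        using that unfolding z sat.simps by (rule someI_ex)
      moreover have "0 < h b \<longleftrightarrow> sat ((nthc c)(?i := n)) F ?p"
        by (simp add: b h truth c')
      moreover have "h a = (if sat (nthc c) F (decode_fm z) then Suc (SOME n. sat ((nthc c)(?i := n)) F ?p) else 0)"
        by (simp add: a h truth_def z)
      ultimately show ?thesis unfolding z sat.simps by (metis Suc_inject nat.distinct(1) neq0_conv)
    qed
    note existential = this
    have z: "z mod 5 = 0 \<Longrightarrow> decode_fm z = Equal (decode_tm (pfst (z div 5))) (decode_tm (psnd (z div 5)))"
      "z mod 5 = 1 \<Longrightarrow> decode_fm z = Less (decode_tm (pfst (z div 5))) (decode_tm (psnd (z div 5)))"
      "z mod 5 = 2 \<Longrightarrow> decode_fm z = Neg (decode_fm (z div 5))"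
      "z mod 5 = 3 \<Longrightarrow> decode_fm z = And (decode_fm (pfst (z div 5))) (decode_fm (psnd (z div 5)))"
      by (simp_all add: decode_fm.simps[of z])
    have ha: "0 < h a \<longleftrightarrow> sat (nthc c) F (decode_fm z)"
      by (simp add: a h truth)
    have equal: "z mod 5 = 0 \<and> b = pr 1 (pr (pfst (z div 5)) c) \<and> d = pr 1 (pr (psnd (z div 5)) c) \<longrightarrow> (0 < h a \<longleftrightarrow> h b = h d)"
      unfolding ha using z by (auto simp: h truth truth0)
    have less: "z mod 5 = 1 \<and> b = pr 1 (pr (pfst (z div 5)) c) \<and> d = pr 1 (pr (psnd (z div 5)) c) \<longrightarrow> (0 < h a \<longleftrightarrow> h b < h d)"
      unfolding ha using z by (auto simp: h truth truth0)
    have neg: "z mod 5 = 2 \<and> b = pr 2 (pr (z div 5) c) \<longrightarrow> (0 < h a \<longleftrightarrow> h b = 0)"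
      unfolding ha using z by (auto simp: h truth truth0)
    have conj: "z mod 5 = 3 \<and> b = pr 2 (pr (pfst (z div 5)) c) \<and> d = pr 2 (pr (psnd (z div 5)) c) \<longrightarrow> (0 < h a \<longleftrightarrow> 0 < h b \<and> 0 < h d)"
      unfolding ha using z by (auto simp: h truth truth0)
    show "(z mod 5 = 0 \<and> b = pr 1 (pr (pfst (z div 5)) c) \<and> d = pr 1 (pr (psnd (z div 5)) c) \<longrightarrow> (0 < h a \<longleftrightarrow> h b = h d)) \<and>
     (z mod 5 = 1 \<and> b = pr 1 (pr (pfst (z div 5)) c) \<and> d = pr 1 (pr (psnd (z div 5)) c) \<longrightarrow> (0 < h a \<longleftrightarrow> h b < h d)) \<and>
     (z mod 5 = 2 \<and> b = pr 2 (pr (z div 5) c) \<longrightarrow> (0 < h a \<longleftrightarrow> h b = 0)) \<and>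
     (z mod 5 = 3 \<and> b = pr 2 (pr (pfst (z div 5)) c) \<and> d = pr 2 (pr (psnd (z div 5)) c) \<longrightarrow> (0 < h a \<longleftrightarrow> 0 < h b \<and> 0 < h d)) \<and>
     (\<forall>c' n. z mod 5 = 4 \<and> b = pr 2 (pr (psnd (z div 5)) c') \<and>
        (\<forall>j. (j = ?i \<longrightarrow> nthc c' j = n) \<and> (j \<noteq> ?i \<longrightarrow> nthc c' j = nthc c j)) \<longrightarrow>
        (h a = 0 \<longrightarrow> h b = 0) \<and> (h a = Suc n \<longrightarrow> 0 < h b))"
    proof (intro conjI equal less neg conj)
      show "\<forall>c' n. z mod 5 = 4 \<and> b = pr 2 (pr (psnd (z div 5)) c') \<and>
        (\<forall>j. (j = ?i \<longrightarrow> nthc c' j = n) \<and> (j \<noteq> ?i \<longrightarrow> nthc c' j = nthc c j)) \<longrightarrow>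
        (h a = 0 \<longrightarrow> h b = 0) \<and> (h a = Suc n \<longrightarrow> 0 < h b)"
        by (intro allI impI, elim conjE, rule existential)
    qed
  qed
  ultimately have "valuation h" by (simp add: valuation_def tarski_def)
  then show ?thesis using that h(1) by blast
qed

lemma valuation_sat:
  "(\<exists>h. valuation h \<and> 0 < h (pr 2 (pr z c))) \<longleftrightarrow> (\<exists>F. sat (nthc c) F (decode_fm z))"
proof
  assume "\<exists>F. sat (nthc c) F (decode_fm z)"
  then obtain F where F: "sat (nthc c) F (decode_fm z)" by blast
  obtain h where h: "valuation h" "\<And>i n. h (pr 0 (pr i n)) = F i n" using valuation_exists[of F] by blast
  from F show "\<exists>h. valuation h \<and> 0 < h (pr 2 (pr z c))"
    using valuation_fm[OF h(1)] h by (intro exI[of _ h]) simp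
qed (use valuation_fm in blast)

section \<open>The forest of partial valuations\<close>

definition partial_valuation :: "nat \<Rightarrow> nat \<Rightarrow> bool" where
  "partial_valuation m c \<longleftrightarrow>
    (\<forall>a b d. a < lenc c \<and> b < lenc c \<and> d < lenc c \<longrightarrow> tarski a b d (nthc c a) (nthc c b) (nthc c d)) \<and>
    (pr 2 m < lenc c \<longrightarrow> 0 < nthc c (pr 2 m))"

text \<open>The component \<open>m\<close>, a formula code paired with an environment code, is
  constant along edges, so every \<open>m\<close> has its own tree, whose branches add one value at
  a time.\<close>

definition tree_edge :: "nat \<Rightarrow> nat \<Rightarrow> bool" where
  "tree_edge y x \<longleftrightarrow> (\<exists>m c c'. x = pr m c \<and> y = pr m c' \<and> lenc c' = Suc (lenc c) \<and>
     (\<forall>i<lenc c. nthc c' i = nthc c i) \<and> partial_valuation m c')"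

definition edges :: "(nat \<times> nat) set" where
  "edges = {(y, x). tree_edge y x}"

definition WF :: "nat set" where
  "WF = Wellfounded.acc edges"

text \<open>A descending sequence of numbers is a single function, so for relations on numbers this
  yields the Pi-1-1 form of well-foundedness.\<close>

lemma not_acc_iff: "x \<notin> Wellfounded.acc E \<longleftrightarrow> (\<exists>f :: nat \<Rightarrow> 'a. f 0 = x \<and> (\<forall>n. (f (Suc n), f n) \<in> E))"
proof
  assume "x \<notin> Wellfounded.acc E"
  then have "\<exists>f :: nat \<Rightarrow> 'a. f 0 = x \<and> (\<forall>n. f n \<notin> Wellfounded.acc E \<and> (f (Suc n), f n) \<in> E)"
    using dependent_nat_choice[of "\<lambda>n z. z \<notin> Wellfounded.acc E \<and> (n = 0 \<longrightarrow> z = x)" "\<lambda>n z z'. (z', z) \<in> E"]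
    by (metis acc.accI nat.distinct(1))
  then show "\<exists>f :: nat \<Rightarrow> 'a. f 0 = x \<and> (\<forall>n. (f (Suc n), f n) \<in> E)" by blast
next
  have "\<forall>f :: nat \<Rightarrow> 'a. f 0 = x \<longrightarrow> (\<exists>n. (f (Suc n), f n) \<notin> E)" if "x \<in> Wellfounded.acc E"
    using that
  proof (induction rule: acc.induct)
    case (accI x)
    show ?case
    proof (intro allI impI)
      fix f :: "nat \<Rightarrow> 'a" assume "f 0 = x"
      show "\<exists>n. (f (Suc n), f n) \<notin> E"
      proof (rule ccontr)
        assume "\<not> ?thesis"
        then have f: "(f (Suc n), f n) \<in> E" for n by blast
        with \<open>f 0 = x\<close> have "(f (Suc 0), x) \<in> E" by metis
        from accI.IH[OF this] f show False by (elim allE[of _ "\<lambda>n. f (Suc n)"]) simp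
      qed
    qed
  qed
  moreover assume "\<exists>f :: nat \<Rightarrow> 'a. f 0 = x \<and> (\<forall>n. (f (Suc n), f n) \<in> E)"
  ultimately show "x \<notin> Wellfounded.acc E" by blast
qed

text \<open>Infinite branches from the empty list are the valuations that make the formula coded in
  \<open>m\<close> true: each clause is checked once its positions are present, and truth once
  position \<open>pr 2 m\<close> is.\<close>

lemma root_not_WF: "pr m 0 \<notin> WF \<longleftrightarrow> (\<exists>h. valuation h \<and> 0 < h (pr 2 m))"
proof
  assume "\<exists>h. valuation h \<and> 0 < h (pr 2 m)"
  then obtain h where h: "valuation h" "0 < h (pr 2 m)" by blast
  define f where "f n = pr m (list_encode (map h [0..<n]))" for n
  have partial: "partial_valuation m (list_encode (map h [0..<n]))" for n
    using h by (simp add: partial_valuation_def nthc_encode valuation_def)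
  have "tree_edge (f (Suc n)) (f n)" for n
    unfolding f_def tree_edge_def
    by (rule exI[of _ m], rule exI[of _ "list_encode (map h [0..<n])"],
        rule exI[of _ "list_encode (map h [0..<Suc n])"]) (simp add: partial nthc_encode nth_map_upt del: upt_Suc)
  then have "(f (Suc n), f n) \<in> edges" for n
    by (simp add: edges_def)
  moreover have "f 0 = pr m 0" by (simp add: f_def)
  ultimately show "pr m 0 \<notin> WF" unfolding WF_def not_acc_iff by blast
next
  assume "pr m 0 \<notin> WF"
  then obtain f where f: "f 0 = pr m 0" "\<And>n. (f (Suc n), f n) \<in> edges"
    unfolding WF_def not_acc_iff by blast
  define c where "c n = psnd (f n)" for n
  have fst: "pfst (f n) = m" for n
  proof (induction n)
    case (Suc n)
    then show ?case using f(2)[of n] by (auto simp: edges_def tree_edge_def)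
  qed (simp add: f(1))
  have step: "lenc (c (Suc n)) = Suc (lenc (c n)) \<and> (\<forall>i<lenc (c n). nthc (c (Suc n)) i = nthc (c n) i) \<and>
    partial_valuation m (c (Suc n))" for n
    using f(2)[of n] fst[of n] by (auto simp: edges_def tree_edge_def c_def)
  have len: "lenc (c n) = n" for n
    by (induction n) (use step in \<open>auto simp: c_def f(1) lenc_def\<close>)
  \<comment> \<open>Node \<open>Suc i\<close> is the first on the branch with an entry at position
    \<open>i\<close>, and later nodes keep that entry.\<close>
  define h where "h i = nthc (c (Suc i)) i" for i
  have nth: "i < n \<Longrightarrow> nthc (c n) i = h i" for i n
  proof (induction n)
    case (Suc n)
    show ?case
    proof (cases "i = n")
      case False
      then show ?thesis using Suc step[of n] by (simp add: len)
    qed (simp add: h_def)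
  qed simp
  have "partial_valuation m (c n)" if "0 < n" for n
    using that step[of "n - 1"] by simp
  note pr = this[unfolded partial_valuation_def len]
  \<comment> \<open>One clause involves three positions, so it has been checked at a level beyond
    all of them.\<close>
  have "tarski a b d (h a) (h b) (h d)" for a b d
    using pr[of "Suc (a + b + d)"] nth[of _ "Suc (a + b + d)"] by simp
  then have "valuation h" by (simp add: valuation_def)
  moreover have "0 < h (pr 2 m)"
    using pr[of "Suc (pr 2 m)"] nth[of _ "Suc (pr 2 m)"] by simp
  ultimately show "\<exists>h. valuation h \<and> 0 < h (pr 2 m)" by blast
qed

text \<open>\<open>Suc (pr n 0)\<close> codes the list \<open>[n]\<close>, so this is the root for
  the formula coded by \<open>z\<close> with \<open>n\<close> in number variable 0.\<close>

definition node :: "nat \<Rightarrow> nat \<Rightarrow> nat" where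
  "node z n = pr (pr z (Suc (pr n 0))) 0"

text \<open>Leading function quantifiers are absorbed by the outer quantifier over the whole
  assignment \<open>F\<close>.\<close>

lemma sigma11_prenex:
  "sigma11_fm p \<Longrightarrow> \<exists>q. arithmetical q \<and> (\<forall>e. (\<exists>F. sat e F p) \<longleftrightarrow> (\<exists>F. sat e F q))"
proof (induction rule: sigma11_fm.induct)
  case (2 p i)
  have "(\<exists>F. sat e F (ExF i p)) \<longleftrightarrow> (\<exists>F. sat e F p)" for e
    by (metis fun_upd_triv sat.simps(6))
  with 2 show ?case by simp
qed blast

text \<open>As \<open>P\<close> ignores functions, its formula holds at one \<open>F\<close> iff it
  holds at some \<open>F\<close>, and satisfiability by some \<open>F\<close> is what the roots
  decide.\<close>

lemma WF_universal:
  assumes "s11 (\<lambda>e F. P (e 0))"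
  obtains z where "\<And>n. P n \<longleftrightarrow> node z n \<notin> WF"
proof -
  obtain p where p: "sigma11_fm p" "\<And>e F. sat e F p \<longleftrightarrow> P (e 0)"
    using assms unfolding s11_def by blast
  obtain q where q: "arithmetical q" "\<And>e. (\<exists>F. sat e F p) \<longleftrightarrow> (\<exists>F. sat e F q)"
    using sigma11_prenex[OF p(1)] by blast
  obtain z where z: "decode_fm z = q" using decode_fm_surj[OF q(1)] by blast
  have "P n \<longleftrightarrow> node z n \<notin> WF" for n
  proof -
    have n: "nthc (Suc (pr n 0)) 0 = n" by (simp add: nthc_def lenc_def)
    show ?thesis
      unfolding node_def root_not_WF valuation_sat z q(2)[symmetric] p(2) n by simp
  qed
  then show ?thesis by (rule that)
qed

section \<open>Definability of the forest and of rank comparison\<close>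

lemma df_node [definable]: "df t \<Longrightarrow> df u \<Longrightarrow> df (\<lambda>e F. node (t e F) (u e F))"
  unfolding node_def by (intro definable)

lemma d11_tarski:
  assumes "df t1" "df t2" "df t3" "df t4" "df t5" "df t6"
  shows "d11 (\<lambda>e F. tarski (t1 e F) (t2 e F) (t3 e F) (t4 e F) (t5 e F) (t6 e F))"
proof -
  have "d11 (\<lambda>e F. tarski (e 0) (e 1) (e 2) (e 3) (e 4) (e 5))"
    unfolding tarski_def tarski_tm_def tarski_fm_def by (intro definable; simp)
  from d11_sub[OF this, where t = "\<lambda>i. [t1, t2, t3, t4, t5, t6] ! min i 5" and G = "\<lambda>i e F. F i"]
  show ?thesis using assms
    by (simp add: definable nth_Cons' numeral_eq_Suc)
qed

lemma d11_edges [definable]: "df t \<Longrightarrow> df u \<Longrightarrow> d11 (\<lambda>e F. (t e F, u e F) \<in> edges)"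
proof (erule (1) d11_sub2[rotated])
  show "d11 (\<lambda>e F. (e 0, e (Suc 0)) \<in> edges)"
    unfolding edges_def tree_edge_def partial_valuation_def mem_Collect_eq prod.case
    by (intro definable d11_tarski)
qed

lemma p11_WF [s11_rules]: "df t \<Longrightarrow> p11 (\<lambda>e F. t e F \<in> WF)"
proof (erule p11_sub1[rotated])
  show "p11 (\<lambda>e F. e 0 \<in> WF)"
    unfolding p11_def WF_def not_acc_iff
    by (intro s11_rules; intro d11_s11 definable)
qed

text \<open>A relation on numbers becomes a function on pairs, with value 1 for related, so that a
  function quantifier ranges over simulations.\<close>

lemma s11_simulated [s11_rules]: "df t \<Longrightarrow> df u \<Longrightarrow> s11 (\<lambda>e F. simulated edges (t e F) (u e F))"
proof (erule (1) s11_sub2[rotated])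
  have "simulated edges a b \<longleftrightarrow> (\<exists>f :: nat \<Rightarrow> nat. f (pr a b) = 1 \<and> (\<forall>x y x'. f (pr x y) = 1 \<longrightarrow> (x', x) \<in> edges \<longrightarrow>
    (\<exists>y'. (y', y) \<in> edges \<and> f (pr x' y') = 1)))" for a b
  proof
    assume "simulated edges a b"
    then obtain Z where "Z a b" "simulation edges Z" unfolding simulated_def by blast
    then show "\<exists>f :: nat \<Rightarrow> nat. f (pr a b) = 1 \<and> (\<forall>x y x'. f (pr x y) = 1 \<longrightarrow> (x', x) \<in> edges \<longrightarrow>
      (\<exists>y'. (y', y) \<in> edges \<and> f (pr x' y') = 1))"
      by (intro exI[of _ "\<lambda>k. of_bool (Z (pfst k) (psnd k))"]) (simp add: simulation_def; blast)
  next
    assume "\<exists>f :: nat \<Rightarrow> nat. f (pr a b) = 1 \<and> (\<forall>x y x'. f (pr x y) = 1 \<longrightarrow> (x', x) \<in> edges \<longrightarrow>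
      (\<exists>y'. (y', y) \<in> edges \<and> f (pr x' y') = 1))"
    then obtain f :: "nat \<Rightarrow> nat" where "f (pr a b) = 1" "\<forall>x y x'. f (pr x y) = 1 \<longrightarrow> (x', x) \<in> edges \<longrightarrow>
      (\<exists>y'. (y', y) \<in> edges \<and> f (pr x' y') = 1)" by blast
    then show "simulated edges a b"
      by (intro simulation_simulated[of _ "\<lambda>x y. f (pr x y) = 1"]) (simp_all add: simulation_def)
  qed
  then show "s11 (\<lambda>e F. simulated edges (e 0) (e (Suc 0)))"
    by (simp only:) (intro s11_exf d11_s11 definable)
qed

lemma s11_rank_less [s11_rules]: "df t \<Longrightarrow> df u \<Longrightarrow> s11 (\<lambda>e F. rank_less edges (t e F) (u e F))"
proof (erule (1) s11_sub2[rotated])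
  show "s11 (\<lambda>e F. rank_less edges (e 0) (e (Suc 0)))"
    unfolding rank_less_def by (intro s11_rules; intro d11_s11 definable)
qed

section \<open>Closed null sets\<close>

abbreviation char_fun :: "cantor \<Rightarrow> nat \<Rightarrow> nat" where
  "char_fun x \<equiv> (\<lambda>n. of_bool (x n))"

definition cylinder :: "cantor \<Rightarrow> nat \<Rightarrow> cantor set" where
  "cylinder y n = {x. \<forall>i<n. x i = y i}"

lemma cylinder_eq_PiE:
  "cylinder y n = (\<Pi>\<^sub>E i\<in>UNIV. if i < n then {y i} else UNIV)"
  by (auto simp: cylinder_def PiE_def Pi_def split: if_splits)

lemma open_bool_singleton: "open {b :: bool}"
proof -
  have "{True} = {False<..}" "{False} = {..<True}" by auto
  then show ?thesis by (cases b) simp_all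
qed

lemma open_cylinder: "open (cylinder y n)"
  unfolding cylinder_eq_PiE
  by (rule open_PiE) (auto intro: finite_subset[of _ "{..<n}"] open_bool_singleton)

lemma closed_cylinder: "closed (cylinder y n)"
proof -
  have "- cylinder y n = (\<Union>z \<in> - cylinder y n. cylinder z n)"
    by (auto simp: cylinder_def)
  then have "open (- cylinder y n)"
    by (metis (no_types, lifting) open_UN open_cylinder)
  then show ?thesis by (simp add: closed_def)
qed

lemma open_contains_cylinder:
  assumes "open U" "x \<in> U"
  obtains n where "cylinder x n \<subseteq> U"
proof -
  from assms obtain X where X: "x \<in> (\<Pi>\<^sub>E i\<in>UNIV. X i)" "finite {i. X i \<noteq> UNIV}" "(\<Pi>\<^sub>E i\<in>UNIV. X i) \<subseteq> U"
    using product_topology_open_contains_basis[of "\<lambda>_. euclidean" UNIV U x]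
    by (auto simp: open_fun_def)
  define n where "n = Suc (Max {i. X i \<noteq> UNIV})"
  have "i < n" if "X i \<noteq> UNIV" for i
    using that X(2) unfolding n_def by (simp add: less_Suc_eq_le)
  then have "t i \<in> X i" if "t \<in> cylinder x n" for t i
    using that X(1) by (cases "X i = UNIV") (auto simp: cylinder_def PiE_iff)
  then have "cylinder x n \<subseteq> (\<Pi>\<^sub>E i\<in>UNIV. X i)" by auto
  from that[OF order_trans[OF this X(3)]] show ?thesis .
qed

lemma closed_cylinder_disjoint:
  assumes "closed A" "x \<notin> A"
  obtains n where "cylinder x n \<inter> A = {}"
proof -
  have "open (- A)" "x \<in> - A" using assms by auto
  then obtain n where "cylinder x n \<subseteq> - A" by (rule open_contains_cylinder)
  then have "cylinder x n \<inter> A = {}" by blast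
  then show ?thesis by (rule that)
qed

interpretation coin: product_prob_space "\<lambda>_. measure_pmf (bernoulli_pmf (1/2))" "UNIV :: nat set"
  by unfold_locales

interpretation fair: prob_space fair_coin_measure
  unfolding fair_coin_measure_def by (rule prob_space_PiM) (rule prob_space_measure_pmf)

lemma space_fair [simp]: "space fair_coin_measure = UNIV"
  by (simp add: fair_coin_measure_def space_PiM PiE_def)

lemma cylinder_eq_emb:
  "cylinder y n = prod_emb UNIV (\<lambda>_. measure_pmf (bernoulli_pmf (1/2))) {..<n} (\<Pi>\<^sub>E i\<in>{..<n}. {y i})"
  by (auto simp: cylinder_def prod_emb_def PiE_def Pi_def space_PiM extensional_def)

lemma cylinder_sets [measurable]: "cylinder y n \<in> sets fair_coin_measure"
  unfolding cylinder_eq_emb fair_coin_measure_def by (rule sets_PiM_I) auto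

lemma measure_cylinder: "measure fair_coin_measure (cylinder y n) = 1 / 2 ^ n"
proof -
  have "emeasure fair_coin_measure (cylinder y n) =
      (\<Prod>i\<in>{..<n}. emeasure (measure_pmf (bernoulli_pmf (1/2))) {y i})"
    unfolding cylinder_eq_emb fair_coin_measure_def by (rule coin.emeasure_PiM_emb) auto
  also have "\<dots> = (\<Prod>i\<in>{..<n}. ennreal (1 / 2))"
    by (intro prod.cong refl) (simp add: emeasure_pmf_single)
  also have "\<dots> = ennreal (1 / 2 ^ n)"
    by (simp add: ennreal_power power_one_over flip: ennreal_half)
  finally show ?thesis by (simp add: measure_def)
qed

text \<open>A closed set is the decreasing intersection of the clopen sets of reals agreeing with
  some member up to \<open>n\<close>; for a null set their measures, which count prefixes, tend to
  0.\<close>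

lemma null_closed_approx:
  assumes "closed A" "A \<in> null_sets fair_coin_measure"
  obtains n where "card ((\<lambda>y. map y [0..<n]) ` A) * 2 ^ k \<le> 2 ^ n"
proof -
  define S where "S n = (\<lambda>y. map y [0..<n]) ` A" for n
  define C where "C s = cylinder (\<lambda>i. s ! i) (length s)" for s :: "bool list"
  define U where "U n = (\<Union>s\<in>S n. C s)" for n
  have fin: "finite (S n)" for n
    by (rule finite_subset[OF _ finite_lists_length_eq[of UNIV n]]) (auto simp: S_def)
  have U: "x \<in> U n \<longleftrightarrow> (\<exists>y\<in>A. \<forall>i<n. x i = y i)" for x n
    by (auto simp: U_def S_def C_def cylinder_def)
  have meas: "U n \<in> sets fair_coin_measure" for n
    unfolding U_def C_def using fin by auto
  have "measure fair_coin_measure (U n) = (\<Sum>s\<in>S n. measure fair_coin_measure (C s))" for n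
    unfolding U_def
  proof (rule fair.finite_measure_finite_Union[OF fin])
    show "disjoint_family_on C (S n)"
      by (auto simp: disjoint_family_on_def S_def C_def cylinder_def)
  qed (auto simp: C_def)
  also have "(\<Sum>s\<in>S n. measure fair_coin_measure (C s)) = (\<Sum>s\<in>S n. 1 / 2 ^ n)" for n
    by (rule sum.cong) (auto simp: C_def measure_cylinder S_def)
  finally have measU: "measure fair_coin_measure (U n) = card (S n) / 2 ^ n" for n
    by simp
  have "(\<Inter>n. U n) = A"
  proof
    show "(\<Inter>n. U n) \<subseteq> A"
    proof
      fix x assume x: "x \<in> (\<Inter>n. U n)"
      show "x \<in> A"
      proof (rule ccontr)
        assume "x \<notin> A"
        then obtain n where n: "cylinder x n \<inter> A = {}" using closed_cylinder_disjoint assms(1) by blast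
        have "x \<in> U n" using x by blast
        then obtain y where "y \<in> A" "\<forall>i<n. x i = y i" unfolding U by blast
        with n show False by (auto simp: cylinder_def)
      qed
    qed
  qed (auto simp: U)
  moreover have "decseq U"
    unfolding decseq_def
  proof (intro allI impI subsetI)
    fix m n x assume "m \<le> n" "x \<in> U n"
    then obtain y where "y \<in> A" "\<forall>i<n. x i = y i" unfolding U by blast
    with \<open>m \<le> n\<close> show "x \<in> U m" unfolding U by (intro bexI[of _ y]) auto
  qed
  then have "(\<lambda>n. measure fair_coin_measure (U n)) \<longlonglongrightarrow> measure fair_coin_measure (\<Inter>n. U n)"
    using meas by (intro fair.finite_Lim_measure_decseq) auto
  ultimately have "(\<lambda>n. measure fair_coin_measure (U n)) \<longlonglongrightarrow> 0"
    using assms(2) by (simp add: null_sets_def measure_def)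
  then have "\<exists>n. measure fair_coin_measure (U n) < 1 / 2 ^ k"
    by (metis order_tendstoD(2) eventually_sequentially order_refl zero_less_divide_1_iff zero_less_numeral zero_less_power)
  then obtain n where "card (S n) / 2 ^ n < 1 / 2 ^ k" unfolding measU by blast
  then have "real (card (S n) * 2 ^ k) \<le> real (2 ^ n)" by (simp add: field_simps)
  then have "card (S n) * 2 ^ k \<le> 2 ^ n" by (rule of_nat_le_iff[THEN iffD1])
  then show ?thesis using that unfolding S_def by blast
qed

text \<open>Cylinders have positive measure, so none lies inside a null set; a point outside the
  closed set \<open>A\<close> has a cylinder off \<open>A\<close>, which may be lengthened.\<close>

lemma null_closed_nowhere_dense:
  assumes "closed A" "A \<in> null_sets fair_coin_measure"
  obtains x m where "x \<in> cylinder y n" "cylinder x m \<inter> A = {}" "n \<le> m"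
proof -
  have "\<not> cylinder y n \<subseteq> A"
  proof
    assume "cylinder y n \<subseteq> A"
    then have "measure fair_coin_measure (cylinder y n) \<le> measure fair_coin_measure A"
      using assms(2) by (intro fair.finite_measure_mono) auto
    moreover have "measure fair_coin_measure A = 0"
      using assms(2) by (simp add: null_sets_def measure_def)
    moreover have "0 < 1 / (2 :: real) ^ n" by simp
    ultimately show False unfolding measure_cylinder by linarith
  qed
  then obtain x where x: "x \<in> cylinder y n" "x \<notin> A" by blast
  obtain m where "cylinder x m \<inter> A = {}" using closed_cylinder_disjoint[OF assms(1) x(2)] .
  moreover have "cylinder x (max n m) \<subseteq> cylinder x m" by (simp add: cylinder_def Collect_mono)
  ultimately have "cylinder x (max n m) \<inter> A = {}" by blast
  with x(1) that[of x "max n m"] show ?thesis by simp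
qed

lemma null_setsI_measure:
  assumes "A \<in> sets fair_coin_measure" "\<And>k. measure fair_coin_measure A \<le> 1 / 2 ^ k"
  shows "A \<in> null_sets fair_coin_measure"
proof -
  have "(\<lambda>k. (1 / 2) ^ k :: real) \<longlonglongrightarrow> 0" by (rule LIMSEQ_power_zero) simp
  then have "measure fair_coin_measure A \<le> 0"
    using assms(2) by (intro LIMSEQ_le_const[of _ 0]) (auto simp: power_one_over)
  then have "measure fair_coin_measure A = 0" by (simp add: measure_le_0_iff)
  then show ?thesis using assms(1) by (simp add: null_sets_def fair.emeasure_eq_measure)
qed

section \<open>Sets of reals as definable predicates\<close>

lemma Sigma11I:
  assumes "s11 (\<lambda>e F. Q (F 0))" shows "{x. Q (char_fun x)} \<in> Sigma11"
  using assms unfolding s11_def Sigma11_def defines_set_def by force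

lemma Pi11I:
  assumes "p11 (\<lambda>e F. Q (F 0))" shows "{x. Q (char_fun x)} \<in> Pi11"
proof -
  have "- {x. Q (char_fun x)} = {x. \<not> Q (char_fun x)}" by blast
  with Sigma11I[of "\<lambda>f. \<not> Q f"] assms show ?thesis by (simp add: p11_def Pi11_def)
qed

lemma char_fun_inverse: "\<forall>i. f i \<le> (1 :: nat) \<Longrightarrow> (\<lambda>i. of_bool (f i = 1)) = f"
  by (auto simp: fun_eq_iff le_Suc_eq)

text \<open>The formula defining \<open>A\<close> is only controlled when function variable 0 is a
  characteristic function, hence the bound by 1.\<close>

lemma Sigma11D:
  assumes "A \<in> Sigma11"
  shows "s11 (\<lambda>e F. (\<forall>i. F 0 i \<le> 1) \<and> (\<lambda>i. F 0 i = 1) \<in> A)"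
proof -
  obtain p where p: "sigma11_fm p" "defines_set p A" using assms unfolding Sigma11_def by blast
  have "s11 (\<lambda>e F. sat e F p)" unfolding s11_def using p(1) by blast
  then have "s11 (\<lambda>e F. (\<forall>i. F 0 i \<le> 1) \<and> sat e F p)"
    by (intro s11_conj) (auto intro!: d11_s11 definable)
  moreover have "sat e F p \<longleftrightarrow> (\<lambda>i. F 0 i = 1) \<in> A" if "\<forall>i. F 0 i \<le> 1" for e F
  proof -
    have "F(0 := (\<lambda>n. of_bool (F 0 n = 1))) = F" using char_fun_inverse[OF that] by auto
    then show ?thesis using p(2) unfolding defines_set_def by metis
  qed
  then have "(\<lambda>e F. (\<forall>i. F 0 i \<le> 1) \<and> sat e F p) = (\<lambda>e F. (\<forall>i. F 0 i \<le> 1) \<and> (\<lambda>i. F 0 i = 1) \<in> A)"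
    by (auto simp: fun_eq_iff)
  ultimately show ?thesis by simp
qed

lemma s11_ex_member:
  assumes "A \<in> Sigma11" "s11 (\<lambda>e F. Q e (F 0))"
  shows "s11 (\<lambda>e F. \<exists>x\<in>A. Q e (char_fun x))"
proof -
  have "s11 (\<lambda>e F. \<exists>f. ((\<forall>i. f i \<le> 1) \<and> (\<lambda>i. f i = 1) \<in> A) \<and> Q e f)"
    by (intro s11_exf s11_conj[OF Sigma11D[OF assms(1)] assms(2)])
  moreover have "(\<exists>f. ((\<forall>i. f i \<le> 1) \<and> (\<lambda>i. f i = 1) \<in> A) \<and> Q e f) \<longleftrightarrow> (\<exists>x\<in>A. Q e (char_fun x))" for e
  proof
    assume "\<exists>f. ((\<forall>i. f i \<le> 1) \<and> (\<lambda>i. f i = 1) \<in> A) \<and> Q e f"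
    then obtain f where f: "\<forall>i. f i \<le> 1" "(\<lambda>i. f i = 1) \<in> A" "Q e f" by blast
    then show "\<exists>x\<in>A. Q e (char_fun x)"
      by (intro bexI[of _ "\<lambda>i. f i = 1"]) (simp_all only: char_fun_inverse[OF f(1)])
  next
    assume "\<exists>x\<in>A. Q e (char_fun x)"
    then obtain x where "x \<in> A" "Q e (char_fun x)" by blast
    then show "\<exists>f. ((\<forall>i. f i \<le> 1) \<and> (\<lambda>i. f i = 1) \<in> A) \<and> Q e f"
      by (intro exI[of _ "char_fun x"]) simp
  qed
  ultimately show ?thesis by simp
qed

text \<open>
  The number \<open>pr n l\<close> codes the clopen set given by a list \<open>l\<close> of strings of length \<open>n\<close>.
\<close>

definition small_code :: "nat \<Rightarrow> nat \<Rightarrow> bool" where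
  "small_code k c \<longleftrightarrow> lenc (psnd c) * 2 ^ k \<le> 2 ^ pfst c"

definition covers :: "nat \<Rightarrow> (nat \<Rightarrow> nat) \<Rightarrow> bool" where
  "covers c f \<longleftrightarrow> (\<exists>j<lenc (psnd c). \<forall>i<pfst c. f i = nthc (nthc (psnd c) j) i)"

text \<open>A listed string with an entry above 1 among its relevant positions matches no
  characteristic function, so only binary strings contribute cylinders.\<close>

lemma clopen_code_eq:
  "{x. covers c (char_fun x)} =
    (\<Union>j\<in>{j. j < lenc (psnd c) \<and> (\<forall>i<pfst c. nthc (nthc (psnd c) j) i \<le> 1)}.
      cylinder (\<lambda>i. nthc (nthc (psnd c) j) i = 1) (pfst c))"
proof -
  have "(\<forall>i<n. char_fun x i = f i) \<longleftrightarrow> (\<forall>i<n. f i \<le> 1) \<and> (\<forall>i<n. x i = (f i = 1))" for x n and f :: "nat \<Rightarrow> nat"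
  proof -
    have "of_bool (x i) = f i \<longleftrightarrow> f i \<le> 1 \<and> x i = (f i = 1)" for i
      by (cases "x i") auto
    then show ?thesis by blast
  qed
  then show ?thesis unfolding covers_def cylinder_def by blast
qed

lemma clopen_code_closed: "closed {x. covers c (char_fun x)}"
  unfolding clopen_code_eq by (intro closed_UN) (auto intro: closed_cylinder)

lemma clopen_code_sets: "{x. covers c (char_fun x)} \<in> sets fair_coin_measure"
  unfolding clopen_code_eq by (intro sets.finite_UN) (auto intro: cylinder_sets)

text \<open>Listed strings may repeat; subadditivity still bounds the measure by their
  number.\<close>

lemma clopen_code_measure:
  assumes "small_code k c"
  shows "measure fair_coin_measure {x. covers c (char_fun x)} \<le> 1 / 2 ^ k"
proof -
  define J where "J = {j. j < lenc (psnd c) \<and> (\<forall>i<pfst c. nthc (nthc (psnd c) j) i \<le> 1)}"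
  have J: "J \<subseteq> {..<lenc (psnd c)}" by (auto simp: J_def)
  then have "finite J" by (rule finite_subset) simp
  then have "measure fair_coin_measure {x. covers c (char_fun x)} \<le>
      (\<Sum>j\<in>J. measure fair_coin_measure (cylinder (\<lambda>i. nthc (nthc (psnd c) j) i = 1) (pfst c)))"
    unfolding clopen_code_eq J_def[symmetric]
    by (intro fair.finite_measure_subadditive_finite) auto
  also have "\<dots> = card J / 2 ^ pfst c" by (simp add: measure_cylinder)
  also have "\<dots> \<le> lenc (psnd c) / 2 ^ pfst c"
    using card_mono[OF _ J] by (intro divide_right_mono) simp_all
  also have "\<dots> \<le> 1 / 2 ^ k"
  proof -
    have "real (lenc (psnd c) * 2 ^ k) \<le> real (2 ^ pfst c)"
      using assms unfolding small_code_def of_nat_le_iff .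
    then show ?thesis by (simp add: field_simps)
  qed
  finally show ?thesis .
qed

lemma null_closed_cover:
  assumes "closed A" "A \<in> null_sets fair_coin_measure"
  obtains c where "small_code k c" "\<forall>x\<in>A. covers c (char_fun x)"
proof -
  obtain n where n: "card ((\<lambda>y. map y [0..<n]) ` A) * 2 ^ k \<le> 2 ^ n" (is "card ?S * _ \<le> _")
    using null_closed_approx[OF assms] .
  have "finite ?S"
    by (rule finite_subset[OF _ finite_lists_length_eq[of UNIV n]]) auto
  then obtain ss where ss: "set ss = ?S" "distinct ss" using finite_distinct_list by blast
  define c where "c = pr n (list_encode (map (\<lambda>s. list_encode (map of_bool s)) ss))"
  have "small_code k c"
    using n by (simp add: small_code_def c_def distinct_card[OF ss(2), symmetric] ss(1))
  moreover have "covers c (char_fun x)" if "x \<in> A" for x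
  proof -
    have "map x [0..<n] \<in> set ss" using ss(1) that by blast
    then obtain j where "j < length ss" "ss ! j = map x [0..<n]" by (auto simp: in_set_conv_nth)
    then show ?thesis by (auto simp: covers_def c_def nthc_encode intro!: exI[of _ j])
  qed
  ultimately show ?thesis using that by blast
qed

lemma d11_small_code: "df t \<Longrightarrow> df u \<Longrightarrow> d11 (\<lambda>e F. small_code (t e F) (u e F))"
  unfolding small_code_def by (intro definable)

lemma d11_covers: "d11 (\<lambda>e F. covers (e i) (F j))"
  unfolding covers_def by (intro definable)

lemma Sigma11_null_subset_Delta11:
  assumes "A \<in> Sigma11" "closed A" "A \<in> null_sets fair_coin_measure"
  obtains B where "B \<in> Delta11" "closed B" "B \<in> null_sets fair_coin_measure" "A \<subseteq> B"
proof -
  \<comment> \<open>Missing a point of \<open>A\<close> is a Sigma-1-1 property of a code, so the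
    universal set turns covering \<open>A\<close> into membership of \<open>node z c\<close> in
    \<open>WF\<close>.\<close>
  have "s11 (\<lambda>e F. \<exists>x\<in>A. \<not> covers (e 0) (char_fun x))"
    by (rule s11_ex_member[OF assms(1)]) (intro d11_s11 d11_neg d11_covers)
  then obtain z where z: "\<And>c. (\<exists>x\<in>A. \<not> covers c (char_fun x)) \<longleftrightarrow> node z c \<notin> WF"
    using WF_universal[of "\<lambda>c. \<exists>x\<in>A. \<not> covers c (char_fun x)"] by blast
  define Q where "Q k c \<longleftrightarrow> select edges (small_code k) (node z) c" for k c
  have unique: "Q k c \<Longrightarrow> Q k d \<Longrightarrow> c = d" for k c d
    unfolding Q_def by (rule select_unique)
  have ex: "\<exists>c. Q k c" for k
  proof -
    obtain c where "small_code k c" "\<forall>x\<in>A. covers c (char_fun x)"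
      using null_closed_cover[OF assms(2,3)] .
    then show ?thesis unfolding Q_def using z by (intro select_exists) (auto simp: WF_def)
  qed
  have p: "p11 (\<lambda>e F. Q (e 0) (e (Suc 0)))"
    unfolding Q_def select_def WF_def[symmetric]
    by (intro s11_rules definable; intro d11_s11 d11_p11 definable d11_small_code)
  \<comment> \<open>Totality and uniqueness exchange holding at \<open>c\<close> for failing at all
    other values, which gives \<open>Q\<close> a Sigma-1-1 form.\<close>
  have Q_iff: "Q k c \<longleftrightarrow> (\<forall>d. d \<noteq> c \<longrightarrow> \<not> Q k d)" for k c
    using unique ex by metis
  have "s11 (\<lambda>e F. \<forall>d. d \<noteq> e (Suc 0) \<longrightarrow> \<not> Q (e 0) d)"
    by (intro s11_rules p11_sub2[OF p] definable; intro d11_s11 definable)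
  then have s: "s11 (\<lambda>e F. Q (e 0) (e (Suc 0)))"
    by (simp only: Q_iff[symmetric])
  \<comment> \<open>\<open>Q\<close> stands in a premise, so its Pi-1-1 form makes \<open>B\<close>
    Sigma-1-1 and its Sigma-1-1 form makes \<open>B\<close> Pi-1-1.\<close>
  define B where "B = {x. \<forall>k c. Q k c \<longrightarrow> covers c (char_fun x)}"
  have "B \<in> Sigma11" unfolding B_def
    by (rule Sigma11I[where Q = "\<lambda>f. \<forall>k c. Q k c \<longrightarrow> covers c f"])
      (intro s11_rules p11_sub2[OF p] definable; intro d11_s11 d11_covers)
  moreover have "B \<in> Pi11" unfolding B_def
    by (rule Pi11I[where Q = "\<lambda>f. \<forall>k c. Q k c \<longrightarrow> covers c f"])
      (intro s11_rules s11_sub2[OF s] definable; intro d11_p11 d11_covers)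
  moreover have "A \<subseteq> B"
  proof
    fix x assume "x \<in> A"
    have "covers c (char_fun x)" if "Q k c" for k c
    proof -
      have "node z c \<in> WF" using that by (simp add: Q_def select_def WF_def)
      with z[of c] \<open>x \<in> A\<close> show ?thesis by blast
    qed
    then show "x \<in> B" by (simp add: B_def)
  qed
  moreover have B_eq: "B = (\<Inter>c\<in>{c. \<exists>k. Q k c}. {x. covers c (char_fun x)})"
    by (auto simp: B_def)
  then have "closed B" using clopen_code_closed by (auto intro: closed_INT)
  moreover have "B \<in> null_sets fair_coin_measure"
  proof (rule null_setsI_measure)
    have "{c. \<exists>k. Q k c} \<noteq> {}" using ex by blast
    then show Bs: "B \<in> sets fair_coin_measure" unfolding B_eq
      by (intro sets.countable_INT') (auto intro: clopen_code_sets)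
    fix k
    obtain c where c: "Q k c" using ex by blast
    then have "measure fair_coin_measure B \<le> measure fair_coin_measure {x. covers c (char_fun x)}"
      by (intro fair.finite_measure_mono clopen_code_sets) (auto simp: B_def)
    also have "\<dots> \<le> 1 / 2 ^ k"
      using c by (intro clopen_code_measure) (simp add: Q_def select_def)
    finally show "measure fair_coin_measure B \<le> 1 / 2 ^ k" .
  qed
  ultimately show ?thesis using that unfolding Delta11_def by blast
qed

section \<open>A singleton separating the two notions\<close>

lemma p11_subF:
  assumes "p11 (\<lambda>e F. P F (e 0) (e (Suc 0)) (e (Suc (Suc 0))))" "df t" "df u" "df v"
  shows "p11 (\<lambda>e F. P F (t e F) (u e F) (v e F))"
  using assms s11_sub[where P = "\<lambda>e F. \<not> P F (e 0) (e (Suc 0)) (e (Suc (Suc 0)))"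
      and t = "\<lambda>i. if i = 0 then t else if i = Suc 0 then u else v" and G = "\<lambda>i e F. F i"]
  by (simp add: definable p11_def)

text \<open>Position \<open>lenc s\<close> holds the verdict on membership in \<open>WF\<close>; the
  next one is a flag, 1 when the stage appends an avoiding extension. The last conjunct keeps the
  string binary.\<close>

definition candidate :: "nat \<Rightarrow> nat \<Rightarrow> nat \<Rightarrow> bool" where
  "candidate s w t \<longleftrightarrow> lenc s + 2 \<le> lenc t \<and> (\<forall>i<lenc s. nthc t i = nthc s i) \<and>
     nthc t (lenc s) = w \<and> nthc t (Suc (lenc s)) = 1 \<and> (\<forall>i. nthc t i \<le> 1)"

text \<open>Flag 0 marks a stage that appends nothing beyond its two bits.\<close>

definition padding :: "nat \<Rightarrow> nat \<Rightarrow> nat \<Rightarrow> bool" where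
  "padding s w t \<longleftrightarrow> lenc t = lenc s + 2 \<and> (\<forall>i<lenc s. nthc t i = nthc s i) \<and>
     nthc t (lenc s) = w \<and> nthc t (Suc (lenc s)) = 0"

text \<open>
  Only the bit 1 at \<open>lenc s\<close>, claiming \<open>p \<in> WF\<close>, is checked here; that a bit 0 is right is not a
  \<open>\<Pi>\<^sup>1\<^sub>1\<close> condition and is enforced by \<open>coherent\<close>.
\<close>

definition step :: "(nat \<Rightarrow> nat) \<Rightarrow> nat \<Rightarrow> nat \<Rightarrow> nat \<Rightarrow> bool" where
  "step f p s t \<longleftrightarrow> (\<forall>i<lenc t. f i = nthc t i) \<and> (f (lenc s) = 1 \<longrightarrow> p \<in> WF) \<and>
     (f (Suc (lenc s)) = 1 \<and> select edges (candidate s (f (lenc s))) (node p) t \<or>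
      f (Suc (lenc s)) = 0 \<and> padding s (f (lenc s)) t)"

text \<open>The history of stages is coded by a number, so that only number quantifiers stand in
  front of the Pi-1-1 relation \<open>step\<close>.\<close>

definition reach :: "(nat \<Rightarrow> nat) \<Rightarrow> nat \<Rightarrow> nat \<Rightarrow> bool" where
  "reach f p s \<longleftrightarrow> (\<exists>c. nthc c 0 = 0 \<and> (\<forall>i<p. step f i (nthc c i) (nthc c (Suc i))) \<and> nthc c p = s)"

definition claims :: "(nat \<Rightarrow> nat) \<Rightarrow> nat \<Rightarrow> nat \<Rightarrow> bool" where
  "claims f p w \<longleftrightarrow> (\<exists>s. reach f p s \<and> f (lenc s) = w)"

text \<open>
  The second conjunct forces \<open>{m. claims f m 1}\<close> to be closed under the rule generating \<open>WF\<close>; it is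
  stated with \<open>claims f m' 0\<close> instead of a negation to remain \<open>\<Pi>\<^sup>1\<^sub>1\<close>.
\<close>

definition coherent :: "(nat \<Rightarrow> nat) \<Rightarrow> bool" where
  "coherent f \<longleftrightarrow>
    (\<forall>p. \<exists>s. reach f p s \<and>
      (f (Suc (lenc s)) = 1 \<or> (\<forall>t. candidate s (f (lenc s)) t \<longrightarrow> claims f (node p t) 0))) \<and>
    (\<forall>m. claims f m 1 \<or> (\<exists>m'. (m', m) \<in> edges \<and> claims f m' 0))"

lemma d11_candidate [definable]:
  "df t \<Longrightarrow> df u \<Longrightarrow> df v \<Longrightarrow> d11 (\<lambda>e F. candidate (t e F) (u e F) (v e F))"
proof (erule (2) d11_sub3[rotated])
  show "d11 (\<lambda>e F. candidate (e 0) (e (Suc 0)) (e (Suc (Suc 0))))"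
    unfolding candidate_def by (intro definable)
qed

lemma p11_step:
  "df t \<Longrightarrow> df u \<Longrightarrow> df v \<Longrightarrow> p11 (\<lambda>e F. step (F 0) (t e F) (u e F) (v e F))"
proof (rule p11_subF[where P = "\<lambda>F. step (F 0)"])
  show "p11 (\<lambda>e F. step (F 0) (e 0) (e (Suc 0)) (e (Suc (Suc 0))))"
    unfolding step_def select_def padding_def WF_def[symmetric]
    by (intro s11_rules definable; intro d11_s11 d11_p11 definable)
qed

lemma p11_reach: "df t \<Longrightarrow> df u \<Longrightarrow> p11 (\<lambda>e F. reach (F 0) (t e F) (u e F))"
proof (rule p11_subF[where P = "\<lambda>F a b c. reach (F 0) a b" and v = "\<lambda>e F. 0"])
  show "p11 (\<lambda>e F. reach (F 0) (e 0) (e (Suc 0)))"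
    unfolding reach_def
    by (intro s11_rules p11_step definable; intro d11_s11 d11_p11 definable)
qed (assumption | rule df_const)+

lemma p11_claims: "df t \<Longrightarrow> df u \<Longrightarrow> p11 (\<lambda>e F. claims (F 0) (t e F) (u e F))"
proof (rule p11_subF[where P = "\<lambda>F a b c. claims (F 0) a b" and v = "\<lambda>e F. 0"])
  show "p11 (\<lambda>e F. claims (F 0) (e 0) (e (Suc 0)))"
    unfolding claims_def
    by (intro s11_rules p11_reach definable; intro d11_s11 d11_p11 definable)
qed (assumption | rule df_const)+

lemma p11_coherent: "p11 (\<lambda>e F. coherent (F 0))"
  unfolding coherent_def
  by (intro s11_rules p11_reach p11_claims definable; intro d11_s11 d11_p11 definable)

section \<open>Uniqueness of the stages read from a function\<close>

lemma reach_0 [simp]: "reach f 0 s \<longleftrightarrow> s = 0"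
proof -
  have "nthc 0 0 = 0" by (simp add: nthc_def lenc_def)
  then show ?thesis unfolding reach_def by auto
qed

lemma reach_Suc: "reach f (Suc p) t \<longleftrightarrow> (\<exists>s. reach f p s \<and> step f p s t)"
proof
  assume "reach f (Suc p) t"
  then obtain c where c: "nthc c 0 = 0" "\<forall>i<Suc p. step f i (nthc c i) (nthc c (Suc i))" "nthc c (Suc p) = t"
    unfolding reach_def by blast
  then have "reach f p (nthc c p)"
    unfolding reach_def by (intro exI[of _ c]) simp
  moreover have "step f p (nthc c p) t" using c(2)[rule_format, of p] c(3) by simp
  ultimately show "\<exists>s. reach f p s \<and> step f p s t" by blast
next
  assume "\<exists>s. reach f p s \<and> step f p s t"
  then obtain s c where c: "nthc c 0 = 0" "\<forall>i<p. step f i (nthc c i) (nthc c (Suc i))" "nthc c p = s"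
    and step: "step f p s t"
    unfolding reach_def by blast
  obtain d where d: "\<forall>i<Suc (Suc p). nthc d i = (if i = Suc p then t else nthc c i)"
    using ex_code[of "Suc (Suc p)" "\<lambda>i. if i = Suc p then t else nthc c i"] by blast
  then have d_le: "nthc d i = nthc c i" if "i \<le> p" for i using that by simp
  have d_Suc: "nthc d (Suc p) = t" using d by simp
  have "step f i (nthc d i) (nthc d (Suc i))" if "i < Suc p" for i
    using that c(2,3) step d_le[of i] d_le[of "Suc i"] d_Suc by (cases "i = p") simp_all
  then show "reach f (Suc p) t"
    unfolding reach_def using d_le[of 0] d_Suc c(1) by (intro exI[of _ d]) simp
qed

lemma padding_unique: "padding s w t \<Longrightarrow> padding s w t' \<Longrightarrow> t = t'"
  by (rule code_eqI) (auto simp: padding_def less_Suc_eq)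

lemma padding_exists: "\<exists>t. padding s w t"
proof -
  obtain t where "lenc t = lenc s + 2"
    "\<forall>i<lenc s + 2. nthc t i = (if i < lenc s then nthc s i else if i = lenc s then w else 0)"
    using ex_code[of "lenc s + 2" "\<lambda>i. if i < lenc s then nthc s i else if i = lenc s then w else 0"]
    by blast
  then show ?thesis by (intro exI[of _ t]) (simp add: padding_def)
qed

lemma step_unique: "step f p s t \<Longrightarrow> step f p s t' \<Longrightarrow> t = t'"
  unfolding step_def using padding_unique select_unique by (metis zero_neq_one)

lemma reach_unique: "reach f p s \<Longrightarrow> reach f p s' \<Longrightarrow> s = s'"
proof (induction p arbitrary: s s')
  case (Suc p)
  then show ?case unfolding reach_Suc using step_unique by metis
qed simp

section \<open>The real built by finite extensions\<close>

definition truth_bit :: "nat \<Rightarrow> nat" where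
  "truth_bit p = of_bool (p \<in> WF)"

text \<open>By \<open>select_unique\<close> and \<open>padding_unique\<close> both choices are
  canonical, so a coherent function can be forced to reproduce them.\<close>

definition next_string :: "nat \<Rightarrow> nat \<Rightarrow> nat" where
  "next_string p s =
    (if \<exists>t. candidate s (truth_bit p) t \<and> node p t \<in> WF
     then SOME t. select edges (candidate s (truth_bit p)) (node p) t
     else SOME t. padding s (truth_bit p) t)"

primrec strings :: "nat \<Rightarrow> nat" where
  "strings 0 = 0"
| "strings (Suc p) = next_string p (strings p)"

text \<open>The string after stage \<open>i\<close> is longer than \<open>i\<close>, so the default
  of \<open>nthc\<close> is never read.\<close>

definition coding_real :: cantor where
  "coding_real i = (nthc (strings (Suc i)) i = 1)"

lemma strings_cases:
  obtains
    (candidate) "select edges (candidate (strings p) (truth_bit p)) (node p) (strings (Suc p))"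
  | (padding) "padding (strings p) (truth_bit p) (strings (Suc p))"
      "\<And>t. candidate (strings p) (truth_bit p) t \<Longrightarrow> node p t \<notin> WF"
proof (cases "\<exists>t. candidate (strings p) (truth_bit p) t \<and> node p t \<in> WF")
  case True
  then have "\<exists>t. select edges (candidate (strings p) (truth_bit p)) (node p) t"
    using select_exists unfolding WF_def by metis
  from someI_ex[OF this] True candidate show ?thesis by (simp add: next_string_def)
next
  case False
  with someI_ex[OF padding_exists[of "strings p" "truth_bit p"]] padding
  show ?thesis by (simp add: next_string_def)
qed

lemma strings_Suc:
  "lenc (strings p) + 2 \<le> lenc (strings (Suc p))"
  "i < lenc (strings p) \<Longrightarrow> nthc (strings (Suc p)) i = nthc (strings p) i"
  "nthc (strings (Suc p)) (lenc (strings p)) = truth_bit p"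
  by (cases rule: strings_cases[of p]; simp add: candidate_def padding_def select_def)+

lemma truth_bit_le_1: "truth_bit p \<le> 1"
  by (simp add: truth_bit_def)

lemma strings_le_1: "nthc (strings p) i \<le> 1"
proof (induction p arbitrary: i)
  case 0
  show ?case by (simp add: nthc_def lenc_def)
next
  case (Suc p)
  show ?case
  proof (cases rule: strings_cases[of p])
    case candidate
    then show ?thesis by (simp add: select_def candidate_def)
  next
    case padding
    then show ?thesis
      using Suc[of i] truth_bit_le_1[of p]
      by (cases "i < lenc (strings p)"; cases "i = lenc (strings p)"; cases "i = Suc (lenc (strings p))")
        (auto simp: padding_def nthc_def)
  qed
qed

lemma strings_mono:
  assumes "p \<le> q" "i < lenc (strings p)"
  shows "i < lenc (strings q) \<and> nthc (strings q) i = nthc (strings p) i"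
  using assms(1)
proof (induction q rule: dec_induct)
  case (step q)
  then show ?case using strings_Suc(1)[of q] strings_Suc(2)[of i q] by (simp del: strings.simps)
qed (use assms in simp)

lemma strings_length: "p \<le> lenc (strings p)"
proof (induction p)
  case (Suc p)
  then show ?case using strings_Suc(1)[of p] by simp
qed simp

lemma coding_real_prefix:
  assumes "i < lenc (strings p)"
  shows "char_fun coding_real i = nthc (strings p) i"
proof -
  have "i < lenc (strings (Suc i))" using strings_length[of "Suc i"] by simp
  then have "nthc (strings (Suc i)) i = nthc (strings p) i"
    using strings_mono[of "Suc i" p i] strings_mono[of p "Suc i" i] assms
    by (cases "Suc i \<le> p") (simp_all del: strings.simps)
  moreover have "of_bool (n = 1) = n" if "n \<le> 1" for n :: nat using that by (cases n) auto
  ultimately show ?thesis using strings_le_1[of p i] by (simp add: coding_real_def del: strings.simps)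
qed

lemma coding_real_bit: "char_fun coding_real (lenc (strings p)) = truth_bit p"
  using coding_real_prefix[of "lenc (strings p)" "Suc p"] strings_Suc(1,3)[of p]
  by (simp del: strings.simps)

lemma coding_real_step: "step (char_fun coding_real) p (strings p) (strings (Suc p))"
proof -
  have "char_fun coding_real (Suc (lenc (strings p))) = nthc (strings (Suc p)) (Suc (lenc (strings p)))"
    using strings_Suc(1)[of p] by (intro coding_real_prefix) (simp del: strings.simps)
  moreover have "truth_bit p = 1 \<longrightarrow> p \<in> WF" by (simp add: truth_bit_def)
  ultimately show ?thesis
    unfolding step_def coding_real_bit using coding_real_prefix[of _ "Suc p"]
    by (cases rule: strings_cases[of p])
      (simp_all add: select_def candidate_def padding_def del: strings.simps)
qed

lemma coding_real_reach: "reach (char_fun coding_real) p s \<longleftrightarrow> s = strings p"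
proof -
  have "reach (char_fun coding_real) p (strings p)"
  proof (induction p)
    case (Suc p)
    then show ?case unfolding reach_Suc using coding_real_step by blast
  qed simp
  then show ?thesis using reach_unique by blast
qed

lemma coding_real_claims: "claims (char_fun coding_real) p w \<longleftrightarrow> truth_bit p = w"
  by (simp add: claims_def coding_real_reach coding_real_bit)

lemma coherent_coding_real: "coherent (char_fun coding_real)"
proof -
  have "char_fun coding_real (Suc (lenc (strings p))) = 1 \<or>
    (\<forall>t. candidate (strings p) (truth_bit p) t \<longrightarrow> truth_bit (node p t) = 0)" for p
  proof (cases rule: strings_cases[of p])
    case candidate
    then have "nthc (strings (Suc p)) (Suc (lenc (strings p))) = 1"
      by (simp add: select_def candidate_def)
    moreover have "char_fun coding_real (Suc (lenc (strings p))) = nthc (strings (Suc p)) (Suc (lenc (strings p)))"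
      using strings_Suc(1)[of p] by (intro coding_real_prefix) (simp del: strings.simps)
    ultimately show ?thesis by metis
  qed (simp add: truth_bit_def)
  \<comment> \<open>A number outside the accessible part has a predecessor outside it.\<close>
  moreover have "truth_bit m = 1 \<or> (\<exists>m'. (m', m) \<in> edges \<and> truth_bit m' = 0)" for m
    unfolding truth_bit_def WF_def using acc.accI[of m edges] by auto
  ultimately show ?thesis
    unfolding coherent_def coding_real_claims coding_real_reach
    by (simp add: coding_real_bit)
qed

text \<open>Positive claims are true by \<open>step\<close>, and induction over \<open>WF\<close>
  shows that every member is claimed. Since claims are unique, negative ones are then true as well,
  and the stage strings are forced one by one.\<close>

lemma coherent_unique:
  assumes "coherent (char_fun y)"
  shows "y = coding_real"
proof -
  let ?f = "char_fun y"
  have reach: "\<exists>s. reach ?f p s" for p using assms unfolding coherent_def by blast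
  have claims_unique: "claims ?f p v \<Longrightarrow> claims ?f p w \<Longrightarrow> v = w" for p v w
    unfolding claims_def using reach_unique by blast
  have "p \<in> WF" if "claims ?f p 1" for p
  proof -
    obtain t where "reach ?f (Suc p) t" using reach by blast
    then obtain s where "reach ?f p s" "step ?f p s t" unfolding reach_Suc by blast
    with that show ?thesis unfolding claims_def step_def using reach_unique by metis
  qed
  moreover have "claims ?f m 1" if "m \<in> WF" for m
    using that unfolding WF_def
  proof (induction rule: acc.induct)
    case (accI m)
    have "claims ?f m 1 \<or> (\<exists>m'. (m', m) \<in> edges \<and> claims ?f m' 0)"
      using assms unfolding coherent_def by blast
    then show ?case using accI.IH claims_unique by (metis zero_neq_one)
  qed
  ultimately have WF: "claims ?f p 1 \<longleftrightarrow> p \<in> WF" for p by blast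
  have bit: "?f (lenc s) = truth_bit p" if "reach ?f p s" for p s
  proof -
    have "claims ?f p (?f (lenc s))" using that unfolding claims_def by blast
    then have "?f (lenc s) = 1 \<longleftrightarrow> p \<in> WF" using WF claims_unique by metis
    then show ?thesis by (cases "y (lenc s)") (simp_all add: truth_bit_def)
  qed
  have strings: "reach ?f p (strings p)" for p
  proof (induction p)
    case (Suc p)
    obtain t where "reach ?f (Suc p) t" using reach by blast
    then have step: "step ?f p (strings p) t"
      unfolding reach_Suc using Suc reach_unique by metis
    have "t = strings (Suc p)"
    proof (cases "?f (Suc (lenc (strings p))) = 1")
      case True
      then have sel: "select edges (candidate (strings p) (truth_bit p)) (node p) t"
        using step unfolding step_def bit[OF Suc] by auto
      show ?thesis
      proof (cases rule: strings_cases[of p])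
        case candidate
        then show ?thesis using sel select_unique by blast
      next
        case padding
        then show ?thesis using sel unfolding select_def WF_def by blast
      qed
    next
      case False
      then have pad: "padding (strings p) (truth_bit p) t"
        using step unfolding step_def bit[OF Suc] by auto
      \<comment> \<open>A flag 0 has to be honest: coherence then makes \<open>?f\<close> deny
        membership in \<open>WF\<close> to the node of every candidate, and denials are already
        known to be true.\<close>
      obtain s where "reach ?f p s" "?f (Suc (lenc s)) = 1 \<or>
        (\<forall>t. candidate s (?f (lenc s)) t \<longrightarrow> claims ?f (node p t) 0)"
        using assms unfolding coherent_def by blast
      moreover from this(1) have "s = strings p" using Suc reach_unique by blast
      ultimately have cand: "candidate (strings p) (truth_bit p) t \<Longrightarrow> claims ?f (node p t) 0" for t
        using False bit[OF Suc] by metis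
      show ?thesis
      proof (cases rule: strings_cases[of p])
        case candidate
        then have "node p (strings (Suc p)) \<in> WF" "claims ?f (node p (strings (Suc p))) 0"
          using cand unfolding select_def WF_def by blast+
        then show ?thesis using WF claims_unique by (metis zero_neq_one)
      next
        case padding
        then show ?thesis using pad padding_unique by blast
      qed
    qed
    with step Suc show ?case unfolding reach_Suc by blast
  qed simp
  show ?thesis
  proof
    fix i
    obtain s where "step ?f i s (strings (Suc i))" using strings[of "Suc i"] unfolding reach_Suc by blast
    moreover have "i < lenc (strings (Suc i))" using strings_length[of "Suc i"] by simp
    ultimately have "?f i = nthc (strings (Suc i)) i" unfolding step_def by blast
    then show "y i = coding_real i" unfolding coding_real_def by (cases "y i") simp_all
  qed
qed

lemma coding_real_Pi11: "{coding_real} \<in> Pi11"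
proof -
  have "{coding_real} = {y. coherent (char_fun y)}"
    using coherent_coding_real coherent_unique by blast
  then show ?thesis using Pi11I[OF p11_coherent] by simp
qed

lemma null_closed_singleton: "closed {x}" "{x} \<in> null_sets fair_coin_measure" for x :: cantor
proof -
  have eq: "{x} = (\<Inter>n. cylinder x n)" by (auto simp: cylinder_def fun_eq_iff)
  then show "closed {x}" by (metis closed_INT closed_cylinder)
  have sets: "{x} \<in> sets fair_coin_measure"
    unfolding eq by (rule sets.countable_INT) (auto intro: cylinder_sets)
  show "{x} \<in> null_sets fair_coin_measure"
  proof (rule null_setsI_measure[OF sets])
    fix k
    have "measure fair_coin_measure {x} \<le> measure fair_coin_measure (cylinder x k)"
      by (rule fair.finite_measure_mono[OF _ cylinder_sets]) (simp add: cylinder_def)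
    then show "measure fair_coin_measure {x} \<le> 1 / 2 ^ k" by (simp add: measure_cylinder)
  qed
qed

text \<open>The universal index \<open>z\<close> of the strings whose cylinder meets
  \<open>A\<close> is also the number of the stage that treats \<open>A\<close>.\<close>

lemma coding_real_avoids:
  assumes "A \<in> Sigma11" "closed A" "A \<in> null_sets fair_coin_measure"
  shows "coding_real \<notin> A"
proof -
  have "s11 (\<lambda>e F. \<exists>x\<in>A. \<forall>i<lenc (e 0). char_fun x i = nthc (e 0) i)"
    by (rule s11_ex_member[OF assms(1), where Q = "\<lambda>e f. \<forall>i<lenc (e 0). f i = nthc (e 0) i"])
      (intro d11_s11 definable)
  then obtain z where z: "\<And>t. (\<exists>x\<in>A. \<forall>i<lenc t. char_fun x i = nthc t i) \<longleftrightarrow> node z t \<notin> WF"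
    using WF_universal[of "\<lambda>t. \<exists>x\<in>A. \<forall>i<lenc t. char_fun x i = nthc t i"] by blast
  define s where "s = strings z"
  \<comment> \<open>After \<open>s\<close> come the verdict and the flag; the default
    \<open>True\<close> supplies the flag 1.\<close>
  define y where "y i = (if i < lenc s then nthc s i = 1 else if i = lenc s then truth_bit z = 1 else True)" for i
  obtain x m where x: "x \<in> cylinder y (lenc s + 2)" "cylinder x m \<inter> A = {}" "lenc s + 2 \<le> m"
    using null_closed_nowhere_dense[OF assms(2,3)] .
  obtain t where t: "lenc t = m" "\<forall>i<m. nthc t i = char_fun x i"
    using ex_code[of m "char_fun x"] by blast
  have bool: "of_bool (n = 1) = n" if "n \<le> 1" for n :: nat using that by (cases n) auto
  have "nthc t i = of_bool (y i)" if "i < lenc s + 2" for i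
    using x(1,3) t(2) that by (simp add: cylinder_def)
  moreover have "nthc t i \<le> 1" for i
    using t by (cases "i < m") (auto simp: nthc_def)
  ultimately have "candidate s (truth_bit z) t"
    unfolding candidate_def
    using x(3) t(1) bool[OF strings_le_1[of z]] bool[OF truth_bit_le_1[of z]] by (simp add: y_def s_def)
  moreover have "node z t \<in> WF"
  proof -
    have "\<not> (\<exists>x\<in>A. \<forall>i<lenc t. char_fun x i = nthc t i)"
      using x(2) t by (auto simp: cylinder_def)
    with z show ?thesis by blast
  qed
  ultimately have "select edges (candidate s (truth_bit z)) (node z) (strings (Suc z))"
    unfolding s_def by (cases rule: strings_cases[of z]) blast+
  \<comment> \<open>Hence \<open>A\<close> misses the cylinder of the string after stage
    \<open>z\<close>, in which the real lies.\<close>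
  then have "node z (strings (Suc z)) \<in> WF" by (simp add: select_def WF_def)
  with z[of "strings (Suc z)"] coding_real_prefix[of _ "Suc z"] show ?thesis by blast
qed

theorem theorem3p2:
  shows "(\<forall>x. kurtz_random Pi11 x \<longrightarrow> kurtz_random Sigma11 x) \<and>
         (\<exists>x. kurtz_random Sigma11 x \<and> \<not> kurtz_random Pi11 x) \<and>
         (\<forall>x. kurtz_random Sigma11 x \<longleftrightarrow> kurtz_random Delta11 x)"
proof (intro conjI)
  \<comment> \<open>Delta-1-1 sets belong to both other classes, so the two implications reduce to
    enlarging a closed null Sigma-1-1 set to a Delta-1-1 one.\<close>
  have "kurtz_random Delta11 x \<Longrightarrow> kurtz_random Sigma11 x" for x
    unfolding kurtz_random_def using Sigma11_null_subset_Delta11 by (metis subsetD)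
  moreover have "kurtz_random Sigma11 x \<Longrightarrow> kurtz_random Delta11 x"
    "kurtz_random Pi11 x \<Longrightarrow> kurtz_random Delta11 x" for x
    unfolding kurtz_random_def Delta11_def by blast+
  ultimately show "\<forall>x. kurtz_random Pi11 x \<longrightarrow> kurtz_random Sigma11 x"
    "\<forall>x. kurtz_random Sigma11 x \<longleftrightarrow> kurtz_random Delta11 x" by blast+
  have "kurtz_random Sigma11 coding_real"
    unfolding kurtz_random_def using coding_real_avoids by blast
  moreover have "\<not> kurtz_random Pi11 coding_real"
    unfolding kurtz_random_def using coding_real_Pi11 null_closed_singleton by blast
  ultimately show "\<exists>x. kurtz_random Sigma11 x \<and> \<not> kurtz_random Pi11 x" by blast
qed

end
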